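(* Let $\mathrm{D.A}$ be any of the calculi $\mathrm{D.TQBA}$, $\mathrm{D.TQBA5}$, $\mathrm{D.IA1}$, $\mathrm{D.IA2}$, $\mathrm{D.IA3}$, $\mathrm{D.PRA}$. Then $\mathrm{D.A}$ enjoys cut elimination and the subformula property: every sequent derivable in $\mathrm{D.A}$ has a derivation in $\mathrm{D.A}$ that uses none of the cut rules, and every formula occurring in a cut-free derivation is a subformula of some formula occurring in the end-sequent.
   Context: **Language of the display calculi.** Three types $\mathsf{D},\mathsf{K}_I,\mathsf{K}_C$. Formulas: $\mathsf{D}$: $A::=p\mid\top\mid\bot\mid\circ_I\alpha\mid\circ_C\xi\mid\neg A\mid A\land A\mid A\lor A$ ($p$ from a denumerable set of propositional variables); $\mathsf{K}_I$: $\alpha::=\blacksquare_I A\mid 1_I\mid 0_I\mid\alpha\cap\alpha\mid\alpha\cup\alpha\mid(\sim\alpha)$; $\mathsf{K}_C$: $\xi::=◆_C A\mid 1_C\mid 0_C\mid\xi\sqcap\xi\mid\xi\sqcup\xi\mid(-\xi)$. Structures (structural connectives carry $\hat{\ },\check{\ },\tilde{\ }$): $X::=A\mid\check\bot\mid\hat\top\mid\tilde\circ_C\Pi\mid\tilde\circ_I\Gamma\mid\tilde\neg X\mid X\,\hat\land\,X\mid X\,\check\lor\,X\mid X\,\hat\succ\,X\mid X\,\check\to\,X$; $\Gamma::=\alpha\mid\check\blacksquare_I X\mid\hat{◆}_I X\mid\check 0_I\mid\hat 1_I\mid\Gamma\,\hat\cap\,\Gamma\mid\Gamma\,\check\cup\,\Gamma\mid\Gamma\,\hat\succ_I\,\Gamma\mid\Gamma\,\check\to_I\,\Gamma\mid(\tilde\sim\Gamma)$;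 $\Pi::=\xi\mid\hat{◆}_C X\mid\check\blacksquare_C X\mid\check 0_C\mid\hat 1_C\mid\Pi\,\hat\sqcap\,\Pi\mid\Pi\,\check\sqcup\,\Pi\mid\Pi\,\hat\succ_C\,\Pi\mid\Pi\,\check\to_C\,\Pi\mid(\tilde-\Pi)$. Here $\hat\succ,\hat\succ_I,\hat\succ_C$ are structural co-implications and $\check\to,\check\to_I,\check\to_C$ structural implications. Items in round brackets belong only to $\mathrm{D.TQBA5}$ and its extensions. Sequents relate two structures of the same type. Variables: $X,Y,Z,W$ of type $\mathsf{D}$; $\Gamma,\Delta,\Lambda$ of type $\mathsf{K}_I$; $\Pi,\Sigma,\Omega$ of type $\mathsf{K}_C$. Below "$S\,/\,S'$" means from $S$ infer $S'$, and "$S\,/\!/\,S'$" means the rule can be applied in both directions. **Rules of $\mathrm{D.TQBA}$.** - Identity $p\vdash p$. Cut in each type: $X\vdash A$ and $A\vdash Y$ / $X\vdash Y$; $\Gamma\vdash\alpha$ and $\alpha\vdash\Delta$ / $\Gamma\vdash\Delta$; $\Pi\vdash\xi$ and $\xi\vdash\Sigma$ / $\Pi\vdash\Sigma$. - Pure display rules: $X\,\hat\land\,Y\vdash Z$ // $Y\vdash X\,\check\to\,Z$; $X\vdash Y\,\check\lor\,Z$ // $Y\,\hat\succ\,X\vdash Z$; $\tilde\neg X\vdash Y$ // $\tilde\neg Y\vdash X$; $X\vdash\tilde\neg Y$ // $Y\vdash\tilde\neg X$; $\Gamma\,\hat\cap\,\Delta\vdash\Lambda$ // $\Delta\vdash\Gamma\,\check\to_I\,\Lambda$;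 $\Gamma\vdash\Delta\,\check\cup\,\Lambda$ // $\Delta\,\hat\succ_I\,\Gamma\vdash\Lambda$; $\Pi\,\hat\sqcap\,\Sigma\vdash\Omega$ // $\Sigma\vdash\Pi\,\check\to_C\,\Omega$; $\Pi\vdash\Sigma\,\check\sqcup\,\Omega$ // $\Sigma\,\hat\succ_C\,\Pi\vdash\Omega$. - Multi-type display rules: $\tilde\circ_I\Gamma\vdash Y$ // $\Gamma\vdash\check\blacksquare_I Y$; $Y\vdash\tilde\circ_I\Gamma$ // $\hat{◆}_I Y\vdash\Gamma$; $Y\vdash\tilde\circ_C\Pi$ // $\hat{◆}_C Y\vdash\Pi$; $\tilde\circ_C\Pi\vdash X$ // $\Pi\vdash\check\blacksquare_C X$. - Pure structural rules: in each type, standard weakening, contraction, commutativity and associativity, for the structural conjunction ($\hat\land,\hat\cap,\hat\sqcap$) on the left of $\vdash$ and the structural disjunction ($\check\lor,\check\cup,\check\sqcup$) on the right; $X\vdash Y$ // $\tilde\neg Y\vdash\tilde\neg X$; $X\vdash Y$ // $X\,\hat\land\,\hat\top\vdash Y$; $X\vdash Y$ // $X\vdash Y\,\check\lor\,\check\bot$; and likewise for $(\hat\cap,\hat 1_I)$, $(\check\cup,\check 0_I)$, $(\hat\sqcap,\hat 1_C)$, $(\check\sqcup,\check 0_C)$. - Multi-type structural rules: $\hat\top\vdash Y$ // $\tilde\circ_I\hat 1_I\vdash Y$; $\Gamma\vdash\check\blacksquare_I\check\bot$ // $\Gamma\vdash\check 0_I$; $\hat{◆}_C\hat\top\vdash\Pi$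 // $\hat 1_C\vdash\Pi$; $X\vdash\check\bot$ // $X\vdash\tilde\circ_C\check 0_C$; $\tilde\circ_I\Gamma\vdash\tilde\circ_I\Delta$ // $\Gamma\vdash\Delta$; $\tilde\circ_C\Pi\vdash\tilde\circ_C\Sigma$ // $\Pi\vdash\Sigma$; $\hat{◆}_C X\vdash\check\blacksquare_C Y$ / $X\vdash Y$; $\hat{◆}_I X\vdash\check\blacksquare_I Y$ / $X\vdash Y$; $X\vdash\tilde\circ_I\check\blacksquare_I\tilde\neg Y$ // $X\vdash\tilde\neg\tilde\circ_C\hat{◆}_C Y$; $X\vdash\tilde\circ_C\check\blacksquare_C\tilde\neg Y$ // $X\vdash\tilde\neg\tilde\circ_I\hat{◆}_I Y$; $\tilde\circ_C\hat{◆}_C\tilde\neg X\vdash Y$ // $\tilde\neg\tilde\circ_I\check\blacksquare_I X\vdash Y$; $\tilde\circ_I\hat{◆}_I\tilde\neg X\vdash Y$ // $\tilde\neg\tilde\circ_C\check\blacksquare_C X\vdash Y$. - Operational rules for pure-type connectives (standard): $\hat\top\vdash\top$; $\hat\top\vdash X$ / $\top\vdash X$; $\bot\vdash\check\bot$; $X\vdash\check\bot$ / $X\vdash\bot$; $A\,\hat\land\,B\vdash X$ / $A\land B\vdash X$; $X\vdash A$ and $Y\vdash B$ / $X\,\hat\land\,Y\vdash A\land B$; $A\vdash X$ and $B\vdash Y$ / $A\lor B\vdash X\,\check\lor\,Y$; $X\vdash A\,\check\lor\,B$ / $X\vdash A\lor B$; $\tilde\neg A\vdash X$ / $\neg A\vdash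 X$; $X\vdash\tilde\neg A$ / $X\vdash\neg A$; and likewise for $1_I,0_I,\cap,\cup$ and $1_C,0_C,\sqcap,\sqcup$. - Operational rules for multi-type connectives: $\Gamma\vdash\check\blacksquare_I A$ / $\Gamma\vdash\blacksquare_I A$; $A\vdash X$ / $\blacksquare_I A\vdash\check\blacksquare_I X$; $\hat{◆}_C A\vdash\Pi$ / $◆_C A\vdash\Pi$; $X\vdash A$ / $\hat{◆}_C X\vdash ◆_C A$; $X\vdash\tilde\circ_I\alpha$ / $X\vdash\circ_I\alpha$; $\tilde\circ_I\alpha\vdash X$ / $\circ_I\alpha\vdash X$; $X\vdash\tilde\circ_C\xi$ / $X\vdash\circ_C\xi$; $\tilde\circ_C\xi\vdash X$ / $\circ_C\xi\vdash X$. **$\mathrm{D.TQBA5}$** adds: $\tilde\sim\Gamma\vdash\Delta$ // $\tilde\sim\Delta\vdash\Gamma$; $\Gamma\vdash\tilde\sim\Delta$ // $\Delta\vdash\tilde\sim\Gamma$; $\tilde-\Pi\vdash\Sigma$ // $\tilde-\Sigma\vdash\Pi$; $\Pi\vdash\tilde-\Sigma$ // $\Sigma\vdash\tilde-\Pi$; $\Gamma\vdash\Delta$ // $\tilde\sim\Delta\vdash\tilde\sim\Gamma$; $\Pi\vdash\Sigma$ // $\tilde-\Sigma\vdash\tilde-\Pi$; $X\vdash\tilde\circ_I\check\blacksquare_I Y$ // $X\vdash\tilde\circ_C\check\blacksquare_C Y$; $X\vdash\tilde\circ_I\tilde\sim\Gamma$ / $X\vdash\tilde\neg\tilde\circ_I\Gamma$;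 $X\vdash\tilde\circ_C\tilde-\Pi$ / $X\vdash\tilde\neg\tilde\circ_C\Pi$; and operational rules $\Gamma\vdash\tilde\sim\alpha$ / $\Gamma\vdash\sim\alpha$; $\tilde\sim\alpha\vdash\Gamma$ / $\sim\alpha\vdash\Gamma$; $\Pi\vdash\tilde-\xi$ / $\Pi\vdash-\xi$; $\tilde-\xi\vdash\Pi$ / $-\xi\vdash\Pi$. **Extensions of $\mathrm{D.TQBA5}$.** $\mathrm{D.IA1}$ adds (cgri): $\Gamma\,\hat\cap\,\Delta\vdash\Lambda$ / $\Delta\vdash\tilde\sim\Gamma\,\check\cup\,\Lambda$ and $\Pi\,\hat\sqcap\,\Sigma\vdash\Omega$ / $\Sigma\vdash\tilde-\Pi\,\check\sqcup\,\Omega$. $\mathrm{D.IA2}$ adds $\Gamma\vdash\check\blacksquare_I(X\,\check\lor\,Y)$ / $\Gamma\vdash\check\blacksquare_I X\,\check\cup\,\check\blacksquare_I Y$ and $\hat{◆}_C(X\,\hat\land\,Y)\vdash\Pi$ / $\hat{◆}_C X\,\hat\sqcap\,\hat{◆}_C Y\vdash\Pi$. $\mathrm{D.IA3}$ adds (ia3): $X\vdash Y$ and $W\vdash Z$ / $X\,\hat\land\,\tilde\circ_C\hat{◆}_C W\vdash\tilde\circ_I\check\blacksquare_I Y\,\check\lor\,Z$. $\mathrm{D.PRA}$ adds all the rules of $\mathrm{D.IA1}$, $\mathrm{D.IA2}$ and $\mathrm{D.IA3}$. *)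

theory Defs
  imports Main
begin

section \<open>Formulas, structures and sequents\<close>

text \<open>
  The datatypes contain the connectives of the largest language; the language of D.TQBA
  (without the negations of the two kernel types) is carved out by the \<open>basic\<close> predicates
  below.
\<close>

datatype fD = PVar nat | TopD | BotD | CircI fI | CircC fC | NegD fD | AndD fD fD | OrD fD fD
and fI = BoxI fD | OneI | ZeroI | CapI fI fI | CupI fI fI | Sim fI
and fC = DiaC fD | OneC | ZeroC | CapC fC fC | CupC fC fC | Minus fC

text \<open>
  Structural connectives: bold symbols for the binary ones, an initial \<open>S\<close> for the others.
  As in the grammar, structures are not restricted by polarity: every structural connective
  may occur on either side of a sequent.
\<close>

datatype sD =
    FmD fD | SBot | STop | SCircC sC | SCircI sI | SNeg sD
  | SAndD sD sD (infixr "\<^bold>\<and>" 65)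
  | SOrD sD sD (infixr "\<^bold>\<or>" 65)
  | SCoimpD sD sD (infixr "\<^bold>\<succ>" 65)
  | SImpD sD sD (infixr "\<^bold>\<rightarrow>" 65)
and sI =
    FmI fI | SBoxI sD | SDiaI sD | SZeroI | SOneI
  | SAndI sI sI (infixr "\<^bold>\<inter>" 65)
  | SOrI sI sI (infixr "\<^bold>\<union>" 65)
  | SCoimpI sI sI (infixr "\<^bold>\<succ>\<^sub>I" 65)
  | SImpI sI sI (infixr "\<^bold>\<rightarrow>\<^sub>I" 65)
  | SSim sI
and sC =
    FmC fC | SDiaC sD | SBoxC sD | SZeroC | SOneC
  | SAndC sC sC (infixr "\<^bold>\<sqinter>" 65)
  | SOrC sC sC (infixr "\<^bold>\<squnion>" 65)
  | SCoimpC sC sC (infixr "\<^bold>\<succ>\<^sub>C" 65)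
  | SImpC sC sC (infixr "\<^bold>\<rightarrow>\<^sub>C" 65)
  | SMinus sC

datatype sequent =
    SeqD sD sD (infix "\<turnstile>\<^sub>D" 50)
  | SeqI sI sI (infix "\<turnstile>\<^sub>I" 50)
  | SeqC sC sC (infix "\<turnstile>\<^sub>C" 50)

text \<open>The language without \<open>Sim\<close>, \<open>Minus\<close> and their structural counterparts.\<close>

primrec basic_fD :: "fD \<Rightarrow> bool" and basic_fI :: "fI \<Rightarrow> bool" and basic_fC :: "fC \<Rightarrow> bool" where
  "basic_fD (PVar p) = True"
| "basic_fD TopD = True"
| "basic_fD BotD = True"
| "basic_fD (CircI a) = basic_fI a"
| "basic_fD (CircC x) = basic_fC x"
| "basic_fD (NegD A) = basic_fD A"
| "basic_fD (AndD A B) = (basic_fD A \<and> basic_fD B)"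
| "basic_fD (OrD A B) = (basic_fD A \<and> basic_fD B)"
| "basic_fI (BoxI A) = basic_fD A"
| "basic_fI OneI = True"
| "basic_fI ZeroI = True"
| "basic_fI (CapI a b) = (basic_fI a \<and> basic_fI b)"
| "basic_fI (CupI a b) = (basic_fI a \<and> basic_fI b)"
| "basic_fI (Sim a) = False"
| "basic_fC (DiaC A) = basic_fD A"
| "basic_fC OneC = True"
| "basic_fC ZeroC = True"
| "basic_fC (CapC x y) = (basic_fC x \<and> basic_fC y)"
| "basic_fC (CupC x y) = (basic_fC x \<and> basic_fC y)"
| "basic_fC (Minus x) = False"

primrec basic_sD :: "sD \<Rightarrow> bool" and basic_sI :: "sI \<Rightarrow> bool" and basic_sC :: "sC \<Rightarrow> bool" where
  "basic_sD (FmD A) = basic_fD A"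
| "basic_sD SBot = True"
| "basic_sD STop = True"
| "basic_sD (SCircC P) = basic_sC P"
| "basic_sD (SCircI G) = basic_sI G"
| "basic_sD (SNeg X) = basic_sD X"
| "basic_sD (X \<^bold>\<and> Y) = (basic_sD X \<and> basic_sD Y)"
| "basic_sD (X \<^bold>\<or> Y) = (basic_sD X \<and> basic_sD Y)"
| "basic_sD (X \<^bold>\<succ> Y) = (basic_sD X \<and> basic_sD Y)"
| "basic_sD (X \<^bold>\<rightarrow> Y) = (basic_sD X \<and> basic_sD Y)"
| "basic_sI (FmI a) = basic_fI a"
| "basic_sI (SBoxI X) = basic_sD X"
| "basic_sI (SDiaI X) = basic_sD X"
| "basic_sI SZeroI = True"
| "basic_sI SOneI = True"
| "basic_sI (G \<^bold>\<inter> D) = (basic_sI G \<and> basic_sI D)"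
| "basic_sI (G \<^bold>\<union> D) = (basic_sI G \<and> basic_sI D)"
| "basic_sI (G \<^bold>\<succ>\<^sub>I D) = (basic_sI G \<and> basic_sI D)"
| "basic_sI (G \<^bold>\<rightarrow>\<^sub>I D) = (basic_sI G \<and> basic_sI D)"
| "basic_sI (SSim G) = False"
| "basic_sC (FmC x) = basic_fC x"
| "basic_sC (SDiaC X) = basic_sD X"
| "basic_sC (SBoxC X) = basic_sD X"
| "basic_sC SZeroC = True"
| "basic_sC SOneC = True"
| "basic_sC (P \<^bold>\<sqinter> S) = (basic_sC P \<and> basic_sC S)"
| "basic_sC (P \<^bold>\<squnion> S) = (basic_sC P \<and> basic_sC S)"
| "basic_sC (P \<^bold>\<succ>\<^sub>C S) = (basic_sC P \<and> basic_sC S)"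
| "basic_sC (P \<^bold>\<rightarrow>\<^sub>C S) = (basic_sC P \<and> basic_sC S)"
| "basic_sC (SMinus P) = False"

primrec basic_sequent :: "sequent \<Rightarrow> bool" where
  "basic_sequent (X \<turnstile>\<^sub>D Y) = (basic_sD X \<and> basic_sD Y)"
| "basic_sequent (G \<turnstile>\<^sub>I D) = (basic_sI G \<and> basic_sI D)"
| "basic_sequent (P \<turnstile>\<^sub>C S) = (basic_sC P \<and> basic_sC S)"


section \<open>Formula occurrences and subformulas\<close>

datatype fm = InD fD | InI fI | InC fC

inductive imm_subfm :: "fm \<Rightarrow> fm \<Rightarrow> bool" where
  "imm_subfm (InI a) (InD (CircI a))"
| "imm_subfm (InC x) (InD (CircC x))"
| "imm_subfm (InD A) (InD (NegD A))"
| "imm_subfm (InD A) (InD (AndD A B))"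
| "imm_subfm (InD B) (InD (AndD A B))"
| "imm_subfm (InD A) (InD (OrD A B))"
| "imm_subfm (InD B) (InD (OrD A B))"
| "imm_subfm (InD A) (InI (BoxI A))"
| "imm_subfm (InI a) (InI (CapI a b))"
| "imm_subfm (InI b) (InI (CapI a b))"
| "imm_subfm (InI a) (InI (CupI a b))"
| "imm_subfm (InI b) (InI (CupI a b))"
| "imm_subfm (InI a) (InI (Sim a))"
| "imm_subfm (InD A) (InC (DiaC A))"
| "imm_subfm (InC x) (InC (CapC x y))"
| "imm_subfm (InC y) (InC (CapC x y))"
| "imm_subfm (InC x) (InC (CupC x y))"
| "imm_subfm (InC y) (InC (CupC x y))"
| "imm_subfm (InC x) (InC (Minus x))"

definition subfm :: "fm \<Rightarrow> fm \<Rightarrow> bool" where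
  "subfm = imm_subfm\<^sup>*\<^sup>*"

text \<open>
  The formulas occurring in a structure are its formula leaves; their proper subformulas are
  not listed, which is immaterial since \<open>subfm\<close> is transitive.
\<close>

primrec fms_sD :: "sD \<Rightarrow> fm set" and fms_sI :: "sI \<Rightarrow> fm set" and fms_sC :: "sC \<Rightarrow> fm set" where
  "fms_sD (FmD A) = {InD A}"
| "fms_sD SBot = {}"
| "fms_sD STop = {}"
| "fms_sD (SCircC P) = fms_sC P"
| "fms_sD (SCircI G) = fms_sI G"
| "fms_sD (SNeg X) = fms_sD X"
| "fms_sD (X \<^bold>\<and> Y) = fms_sD X \<union> fms_sD Y"
| "fms_sD (X \<^bold>\<or> Y) = fms_sD X \<union> fms_sD Y"
| "fms_sD (X \<^bold>\<succ> Y) = fms_sD X \<union> fms_sD Y"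
| "fms_sD (X \<^bold>\<rightarrow> Y) = fms_sD X \<union> fms_sD Y"
| "fms_sI (FmI a) = {InI a}"
| "fms_sI (SBoxI X) = fms_sD X"
| "fms_sI (SDiaI X) = fms_sD X"
| "fms_sI SZeroI = {}"
| "fms_sI SOneI = {}"
| "fms_sI (G \<^bold>\<inter> D) = fms_sI G \<union> fms_sI D"
| "fms_sI (G \<^bold>\<union> D) = fms_sI G \<union> fms_sI D"
| "fms_sI (G \<^bold>\<succ>\<^sub>I D) = fms_sI G \<union> fms_sI D"
| "fms_sI (G \<^bold>\<rightarrow>\<^sub>I D) = fms_sI G \<union> fms_sI D"
| "fms_sI (SSim G) = fms_sI G"
| "fms_sC (FmC x) = {InC x}"
| "fms_sC (SDiaC X) = fms_sD X"
| "fms_sC (SBoxC X) = fms_sD X"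
| "fms_sC SZeroC = {}"
| "fms_sC SOneC = {}"
| "fms_sC (P \<^bold>\<sqinter> S) = fms_sC P \<union> fms_sC S"
| "fms_sC (P \<^bold>\<squnion> S) = fms_sC P \<union> fms_sC S"
| "fms_sC (P \<^bold>\<succ>\<^sub>C S) = fms_sC P \<union> fms_sC S"
| "fms_sC (P \<^bold>\<rightarrow>\<^sub>C S) = fms_sC P \<union> fms_sC S"
| "fms_sC (SMinus P) = fms_sC P"

primrec fms_sequent :: "sequent \<Rightarrow> fm set" where
  "fms_sequent (X \<turnstile>\<^sub>D Y) = fms_sD X \<union> fms_sD Y"
| "fms_sequent (G \<turnstile>\<^sub>I D) = fms_sI G \<union> fms_sI D"
| "fms_sequent (P \<turnstile>\<^sub>C S) = fms_sC P \<union> fms_sC S"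


section \<open>Rules\<close>

text \<open>
  A rule is the relation between the premise list and the conclusion of its instances.
  The \<open>_inv\<close> predicates collect the two-way rules.
\<close>

type_synonym rules = "sequent list \<Rightarrow> sequent \<Rightarrow> bool"

inductive cut_rule :: rules where
  cutD: "cut_rule [X \<turnstile>\<^sub>D FmD A, FmD A \<turnstile>\<^sub>D Y] (X \<turnstile>\<^sub>D Y)"
| cutI: "cut_rule [G \<turnstile>\<^sub>I FmI a, FmI a \<turnstile>\<^sub>I H] (G \<turnstile>\<^sub>I H)"
| cutC: "cut_rule [P \<turnstile>\<^sub>C FmC x, FmC x \<turnstile>\<^sub>C S] (P \<turnstile>\<^sub>C S)"

inductive tqba_inv :: "sequent \<Rightarrow> sequent \<Rightarrow> bool" where
  res_andD: "tqba_inv (X \<^bold>\<and> Y \<turnstile>\<^sub>D Z) (Y \<turnstile>\<^sub>D X \<^bold>\<rightarrow> Z)"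
| res_orD: "tqba_inv (X \<turnstile>\<^sub>D Y \<^bold>\<or> Z) (Y \<^bold>\<succ> X \<turnstile>\<^sub>D Z)"
| res_andI: "tqba_inv (G \<^bold>\<inter> H \<turnstile>\<^sub>I K) (H \<turnstile>\<^sub>I G \<^bold>\<rightarrow>\<^sub>I K)"
| res_orI: "tqba_inv (G \<turnstile>\<^sub>I H \<^bold>\<union> K) (H \<^bold>\<succ>\<^sub>I G \<turnstile>\<^sub>I K)"
| res_andC: "tqba_inv (P \<^bold>\<sqinter> S \<turnstile>\<^sub>C Q) (S \<turnstile>\<^sub>C P \<^bold>\<rightarrow>\<^sub>C Q)"
| res_orC: "tqba_inv (P \<turnstile>\<^sub>C S \<^bold>\<squnion> Q) (S \<^bold>\<succ>\<^sub>C P \<turnstile>\<^sub>C Q)"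
| gal_negL: "tqba_inv (SNeg X \<turnstile>\<^sub>D Y) (SNeg Y \<turnstile>\<^sub>D X)"
| gal_negR: "tqba_inv (X \<turnstile>\<^sub>D SNeg Y) (Y \<turnstile>\<^sub>D SNeg X)"
| adj_circI_boxI: "tqba_inv (SCircI G \<turnstile>\<^sub>D Y) (G \<turnstile>\<^sub>I SBoxI Y)"
| adj_diaI_circI: "tqba_inv (Y \<turnstile>\<^sub>D SCircI G) (SDiaI Y \<turnstile>\<^sub>I G)"
| adj_diaC_circC: "tqba_inv (Y \<turnstile>\<^sub>D SCircC P) (SDiaC Y \<turnstile>\<^sub>C P)"
| adj_circC_boxC: "tqba_inv (SCircC P \<turnstile>\<^sub>D X) (P \<turnstile>\<^sub>C SBoxC X)"
| assoc_andD: "tqba_inv (X \<^bold>\<and> (Y \<^bold>\<and> Z) \<turnstile>\<^sub>D W) ((X \<^bold>\<and> Y) \<^bold>\<and> Z \<turnstile>\<^sub>D W)"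
| assoc_orD: "tqba_inv (W \<turnstile>\<^sub>D X \<^bold>\<or> (Y \<^bold>\<or> Z)) (W \<turnstile>\<^sub>D (X \<^bold>\<or> Y) \<^bold>\<or> Z)"
| unit_andD: "tqba_inv (X \<turnstile>\<^sub>D Y) (X \<^bold>\<and> STop \<turnstile>\<^sub>D Y)"
| unit_orD: "tqba_inv (X \<turnstile>\<^sub>D Y) (X \<turnstile>\<^sub>D Y \<^bold>\<or> SBot)"
| assoc_andI: "tqba_inv (G \<^bold>\<inter> (H \<^bold>\<inter> K) \<turnstile>\<^sub>I L) ((G \<^bold>\<inter> H) \<^bold>\<inter> K \<turnstile>\<^sub>I L)"
| assoc_orI: "tqba_inv (L \<turnstile>\<^sub>I G \<^bold>\<union> (H \<^bold>\<union> K)) (L \<turnstile>\<^sub>I (G \<^bold>\<union> H) \<^bold>\<union> K)"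
| unit_andI: "tqba_inv (G \<turnstile>\<^sub>I H) (G \<^bold>\<inter> SOneI \<turnstile>\<^sub>I H)"
| unit_orI: "tqba_inv (G \<turnstile>\<^sub>I H) (G \<turnstile>\<^sub>I H \<^bold>\<union> SZeroI)"
| assoc_andC: "tqba_inv (P \<^bold>\<sqinter> (S \<^bold>\<sqinter> Q) \<turnstile>\<^sub>C R) ((P \<^bold>\<sqinter> S) \<^bold>\<sqinter> Q \<turnstile>\<^sub>C R)"
| assoc_orC: "tqba_inv (R \<turnstile>\<^sub>C P \<^bold>\<squnion> (S \<^bold>\<squnion> Q)) (R \<turnstile>\<^sub>C (P \<^bold>\<squnion> S) \<^bold>\<squnion> Q)"
| unit_andC: "tqba_inv (P \<turnstile>\<^sub>C S) (P \<^bold>\<sqinter> SOneC \<turnstile>\<^sub>C S)"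
| unit_orC: "tqba_inv (P \<turnstile>\<^sub>C S) (P \<turnstile>\<^sub>C S \<^bold>\<squnion> SZeroC)"
| contraposD: "tqba_inv (X \<turnstile>\<^sub>D Y) (SNeg Y \<turnstile>\<^sub>D SNeg X)"
| top_oneI: "tqba_inv (STop \<turnstile>\<^sub>D Y) (SCircI SOneI \<turnstile>\<^sub>D Y)"
| bot_zeroI: "tqba_inv (G \<turnstile>\<^sub>I SBoxI SBot) (G \<turnstile>\<^sub>I SZeroI)"
| top_oneC: "tqba_inv (SDiaC STop \<turnstile>\<^sub>C P) (SOneC \<turnstile>\<^sub>C P)"
| bot_zeroC: "tqba_inv (X \<turnstile>\<^sub>D SBot) (X \<turnstile>\<^sub>D SCircC SZeroC)"
| circI: "tqba_inv (SCircI G \<turnstile>\<^sub>D SCircI H) (G \<turnstile>\<^sub>I H)"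
| circC: "tqba_inv (SCircC P \<turnstile>\<^sub>D SCircC S) (P \<turnstile>\<^sub>C S)"
| neg_boxI: "tqba_inv (X \<turnstile>\<^sub>D SCircI (SBoxI (SNeg Y))) (X \<turnstile>\<^sub>D SNeg (SCircC (SDiaC Y)))"
| neg_boxC: "tqba_inv (X \<turnstile>\<^sub>D SCircC (SBoxC (SNeg Y))) (X \<turnstile>\<^sub>D SNeg (SCircI (SDiaI Y)))"
| neg_diaC: "tqba_inv (SCircC (SDiaC (SNeg X)) \<turnstile>\<^sub>D Y) (SNeg (SCircI (SBoxI X)) \<turnstile>\<^sub>D Y)"
| neg_diaI: "tqba_inv (SCircI (SDiaI (SNeg X)) \<turnstile>\<^sub>D Y) (SNeg (SCircC (SBoxC X)) \<turnstile>\<^sub>D Y)"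

inductive tqba_rule :: rules where
  down: "tqba_inv S S' \<Longrightarrow> tqba_rule [S] S'"
| up: "tqba_inv S S' \<Longrightarrow> tqba_rule [S'] S"
| idp: "tqba_rule [] (FmD (PVar p) \<turnstile>\<^sub>D FmD (PVar p))"
| weakLD: "tqba_rule [X \<turnstile>\<^sub>D Y] (X \<^bold>\<and> Z \<turnstile>\<^sub>D Y)"
| weakRD: "tqba_rule [X \<turnstile>\<^sub>D Y] (X \<turnstile>\<^sub>D Y \<^bold>\<or> Z)"
| contrLD: "tqba_rule [X \<^bold>\<and> X \<turnstile>\<^sub>D Y] (X \<turnstile>\<^sub>D Y)"
| contrRD: "tqba_rule [X \<turnstile>\<^sub>D Y \<^bold>\<or> Y] (X \<turnstile>\<^sub>D Y)"
| commLD: "tqba_rule [X \<^bold>\<and> Y \<turnstile>\<^sub>D Z] (Y \<^bold>\<and> X \<turnstile>\<^sub>D Z)"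
| commRD: "tqba_rule [X \<turnstile>\<^sub>D Y \<^bold>\<or> Z] (X \<turnstile>\<^sub>D Z \<^bold>\<or> Y)"
| weakLI: "tqba_rule [G \<turnstile>\<^sub>I H] (G \<^bold>\<inter> K \<turnstile>\<^sub>I H)"
| weakRI: "tqba_rule [G \<turnstile>\<^sub>I H] (G \<turnstile>\<^sub>I H \<^bold>\<union> K)"
| contrLI: "tqba_rule [G \<^bold>\<inter> G \<turnstile>\<^sub>I H] (G \<turnstile>\<^sub>I H)"
| contrRI: "tqba_rule [G \<turnstile>\<^sub>I H \<^bold>\<union> H] (G \<turnstile>\<^sub>I H)"
| commLI: "tqba_rule [G \<^bold>\<inter> H \<turnstile>\<^sub>I K] (H \<^bold>\<inter> G \<turnstile>\<^sub>I K)"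
| commRI: "tqba_rule [G \<turnstile>\<^sub>I H \<^bold>\<union> K] (G \<turnstile>\<^sub>I K \<^bold>\<union> H)"
| weakLC: "tqba_rule [P \<turnstile>\<^sub>C S] (P \<^bold>\<sqinter> Q \<turnstile>\<^sub>C S)"
| weakRC: "tqba_rule [P \<turnstile>\<^sub>C S] (P \<turnstile>\<^sub>C S \<^bold>\<squnion> Q)"
| contrLC: "tqba_rule [P \<^bold>\<sqinter> P \<turnstile>\<^sub>C S] (P \<turnstile>\<^sub>C S)"
| contrRC: "tqba_rule [P \<turnstile>\<^sub>C S \<^bold>\<squnion> S] (P \<turnstile>\<^sub>C S)"
| commLC: "tqba_rule [P \<^bold>\<sqinter> S \<turnstile>\<^sub>C Q] (S \<^bold>\<sqinter> P \<turnstile>\<^sub>C Q)"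
| commRC: "tqba_rule [P \<turnstile>\<^sub>C S \<^bold>\<squnion> Q] (P \<turnstile>\<^sub>C Q \<^bold>\<squnion> S)"
| dia_boxC: "tqba_rule [SDiaC X \<turnstile>\<^sub>C SBoxC Y] (X \<turnstile>\<^sub>D Y)"
| dia_boxI: "tqba_rule [SDiaI X \<turnstile>\<^sub>I SBoxI Y] (X \<turnstile>\<^sub>D Y)"
| topRD: "tqba_rule [] (STop \<turnstile>\<^sub>D FmD TopD)"
| topLD: "tqba_rule [STop \<turnstile>\<^sub>D X] (FmD TopD \<turnstile>\<^sub>D X)"
| botLD: "tqba_rule [] (FmD BotD \<turnstile>\<^sub>D SBot)"
| botRD: "tqba_rule [X \<turnstile>\<^sub>D SBot] (X \<turnstile>\<^sub>D FmD BotD)"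
| andLD: "tqba_rule [FmD A \<^bold>\<and> FmD B \<turnstile>\<^sub>D X] (FmD (AndD A B) \<turnstile>\<^sub>D X)"
| andRD: "tqba_rule [X \<turnstile>\<^sub>D FmD A, Y \<turnstile>\<^sub>D FmD B] (X \<^bold>\<and> Y \<turnstile>\<^sub>D FmD (AndD A B))"
| orLD: "tqba_rule [FmD A \<turnstile>\<^sub>D X, FmD B \<turnstile>\<^sub>D Y] (FmD (OrD A B) \<turnstile>\<^sub>D X \<^bold>\<or> Y)"
| orRD: "tqba_rule [X \<turnstile>\<^sub>D FmD A \<^bold>\<or> FmD B] (X \<turnstile>\<^sub>D FmD (OrD A B))"
| topRI: "tqba_rule [] (SOneI \<turnstile>\<^sub>I FmI OneI)"
| topLI: "tqba_rule [SOneI \<turnstile>\<^sub>I G] (FmI OneI \<turnstile>\<^sub>I G)"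
| botLI: "tqba_rule [] (FmI ZeroI \<turnstile>\<^sub>I SZeroI)"
| botRI: "tqba_rule [G \<turnstile>\<^sub>I SZeroI] (G \<turnstile>\<^sub>I FmI ZeroI)"
| andLI: "tqba_rule [FmI a \<^bold>\<inter> FmI b \<turnstile>\<^sub>I G] (FmI (CapI a b) \<turnstile>\<^sub>I G)"
| andRI: "tqba_rule [G \<turnstile>\<^sub>I FmI a, H \<turnstile>\<^sub>I FmI b] (G \<^bold>\<inter> H \<turnstile>\<^sub>I FmI (CapI a b))"
| orLI: "tqba_rule [FmI a \<turnstile>\<^sub>I G, FmI b \<turnstile>\<^sub>I H] (FmI (CupI a b) \<turnstile>\<^sub>I G \<^bold>\<union> H)"
| orRI: "tqba_rule [G \<turnstile>\<^sub>I FmI a \<^bold>\<union> FmI b] (G \<turnstile>\<^sub>I FmI (CupI a b))"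
| topRC: "tqba_rule [] (SOneC \<turnstile>\<^sub>C FmC OneC)"
| topLC: "tqba_rule [SOneC \<turnstile>\<^sub>C P] (FmC OneC \<turnstile>\<^sub>C P)"
| botLC: "tqba_rule [] (FmC ZeroC \<turnstile>\<^sub>C SZeroC)"
| botRC: "tqba_rule [P \<turnstile>\<^sub>C SZeroC] (P \<turnstile>\<^sub>C FmC ZeroC)"
| andLC: "tqba_rule [FmC x \<^bold>\<sqinter> FmC y \<turnstile>\<^sub>C P] (FmC (CapC x y) \<turnstile>\<^sub>C P)"
| andRC: "tqba_rule [P \<turnstile>\<^sub>C FmC x, S \<turnstile>\<^sub>C FmC y] (P \<^bold>\<sqinter> S \<turnstile>\<^sub>C FmC (CapC x y))"
| orLC: "tqba_rule [FmC x \<turnstile>\<^sub>C P, FmC y \<turnstile>\<^sub>C S] (FmC (CupC x y) \<turnstile>\<^sub>C P \<^bold>\<squnion> S)"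
| orRC: "tqba_rule [P \<turnstile>\<^sub>C FmC x \<^bold>\<squnion> FmC y] (P \<turnstile>\<^sub>C FmC (CupC x y))"
| negL: "tqba_rule [SNeg (FmD A) \<turnstile>\<^sub>D X] (FmD (NegD A) \<turnstile>\<^sub>D X)"
| negR: "tqba_rule [X \<turnstile>\<^sub>D SNeg (FmD A)] (X \<turnstile>\<^sub>D FmD (NegD A))"
| boxIR: "tqba_rule [G \<turnstile>\<^sub>I SBoxI (FmD A)] (G \<turnstile>\<^sub>I FmI (BoxI A))"
| boxIL: "tqba_rule [FmD A \<turnstile>\<^sub>D X] (FmI (BoxI A) \<turnstile>\<^sub>I SBoxI X)"
| diaCL: "tqba_rule [SDiaC (FmD A) \<turnstile>\<^sub>C P] (FmC (DiaC A) \<turnstile>\<^sub>C P)"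
| diaCR: "tqba_rule [X \<turnstile>\<^sub>D FmD A] (SDiaC X \<turnstile>\<^sub>C FmC (DiaC A))"
| circIR: "tqba_rule [X \<turnstile>\<^sub>D SCircI (FmI a)] (X \<turnstile>\<^sub>D FmD (CircI a))"
| circIL: "tqba_rule [SCircI (FmI a) \<turnstile>\<^sub>D X] (FmD (CircI a) \<turnstile>\<^sub>D X)"
| circCR: "tqba_rule [X \<turnstile>\<^sub>D SCircC (FmC x)] (X \<turnstile>\<^sub>D FmD (CircC x))"
| circCL: "tqba_rule [SCircC (FmC x) \<turnstile>\<^sub>D X] (FmD (CircC x) \<turnstile>\<^sub>D X)"

inductive tqba5_inv :: "sequent \<Rightarrow> sequent \<Rightarrow> bool" where
  gal_simL: "tqba5_inv (SSim G \<turnstile>\<^sub>I H) (SSim H \<turnstile>\<^sub>I G)"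
| gal_simR: "tqba5_inv (G \<turnstile>\<^sub>I SSim H) (H \<turnstile>\<^sub>I SSim G)"
| gal_minusL: "tqba5_inv (SMinus P \<turnstile>\<^sub>C S) (SMinus S \<turnstile>\<^sub>C P)"
| gal_minusR: "tqba5_inv (P \<turnstile>\<^sub>C SMinus S) (S \<turnstile>\<^sub>C SMinus P)"
| contraposI: "tqba5_inv (G \<turnstile>\<^sub>I H) (SSim H \<turnstile>\<^sub>I SSim G)"
| contraposC: "tqba5_inv (P \<turnstile>\<^sub>C S) (SMinus S \<turnstile>\<^sub>C SMinus P)"
| boxI_boxC: "tqba5_inv (X \<turnstile>\<^sub>D SCircI (SBoxI Y)) (X \<turnstile>\<^sub>D SCircC (SBoxC Y))"

inductive tqba5_rule :: rules where
  down: "tqba5_inv S S' \<Longrightarrow> tqba5_rule [S] S'"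
| up: "tqba5_inv S S' \<Longrightarrow> tqba5_rule [S'] S"
| circI_sim: "tqba5_rule [X \<turnstile>\<^sub>D SCircI (SSim G)] (X \<turnstile>\<^sub>D SNeg (SCircI G))"
| circC_minus: "tqba5_rule [X \<turnstile>\<^sub>D SCircC (SMinus P)] (X \<turnstile>\<^sub>D SNeg (SCircC P))"
| simR: "tqba5_rule [G \<turnstile>\<^sub>I SSim (FmI a)] (G \<turnstile>\<^sub>I FmI (Sim a))"
| simL: "tqba5_rule [SSim (FmI a) \<turnstile>\<^sub>I G] (FmI (Sim a) \<turnstile>\<^sub>I G)"
| minusR: "tqba5_rule [P \<turnstile>\<^sub>C SMinus (FmC x)] (P \<turnstile>\<^sub>C FmC (Minus x))"
| minusL: "tqba5_rule [SMinus (FmC x) \<turnstile>\<^sub>C P] (FmC (Minus x) \<turnstile>\<^sub>C P)"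

inductive ia1_rule :: rules where
  cgriI: "ia1_rule [G \<^bold>\<inter> H \<turnstile>\<^sub>I K] (H \<turnstile>\<^sub>I SSim G \<^bold>\<union> K)"
| cgriC: "ia1_rule [P \<^bold>\<sqinter> S \<turnstile>\<^sub>C Q] (S \<turnstile>\<^sub>C SMinus P \<^bold>\<squnion> Q)"

inductive ia2_rule :: rules where
  boxI_or: "ia2_rule [G \<turnstile>\<^sub>I SBoxI (X \<^bold>\<or> Y)] (G \<turnstile>\<^sub>I SBoxI X \<^bold>\<union> SBoxI Y)"
| diaC_and: "ia2_rule [SDiaC (X \<^bold>\<and> Y) \<turnstile>\<^sub>C P] (SDiaC X \<^bold>\<sqinter> SDiaC Y \<turnstile>\<^sub>C P)"

inductive ia3_rule :: rules where
  ia3: "ia3_rule [X \<turnstile>\<^sub>D Y, W \<turnstile>\<^sub>D Z] (X \<^bold>\<and> SCircC (SDiaC W) \<turnstile>\<^sub>D SCircI (SBoxI Y) \<^bold>\<or> Z)"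


section \<open>Calculi and derivations\<close>

datatype calculus = TQBA | TQBA5 | IA1 | IA2 | IA3 | PRA

definition in_language :: "calculus \<Rightarrow> sequent \<Rightarrow> bool" where
  "in_language c S \<longleftrightarrow> (c = TQBA \<longrightarrow> basic_sequent S)"

primrec noncut_rule :: "calculus \<Rightarrow> rules" where
  "noncut_rule TQBA Ps S = tqba_rule Ps S"
| "noncut_rule TQBA5 Ps S = (tqba_rule Ps S \<or> tqba5_rule Ps S)"
| "noncut_rule IA1 Ps S = (tqba_rule Ps S \<or> tqba5_rule Ps S \<or> ia1_rule Ps S)"
| "noncut_rule IA2 Ps S = (tqba_rule Ps S \<or> tqba5_rule Ps S \<or> ia2_rule Ps S)"
| "noncut_rule IA3 Ps S = (tqba_rule Ps S \<or> tqba5_rule Ps S \<or> ia3_rule Ps S)"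
| "noncut_rule PRA Ps S =
    (tqba_rule Ps S \<or> tqba5_rule Ps S \<or> ia1_rule Ps S \<or> ia2_rule Ps S \<or> ia3_rule Ps S)"

definition calculus_rule :: "calculus \<Rightarrow> rules" where
  "calculus_rule c Ps S \<longleftrightarrow> noncut_rule c Ps S \<or> cut_rule Ps S"

text \<open>A derivation is a tree of sequents; the first argument of \<open>Infer\<close> is the conclusion.\<close>

datatype deriv = Infer sequent "deriv list"

primrec end_sequent :: "deriv \<Rightarrow> sequent" where
  "end_sequent (Infer S ds) = S"

fun sequents :: "deriv \<Rightarrow> sequent set" where
  "sequents (Infer S ds) = insert S (\<Union>d\<in>set ds. sequents d)"

fun built_by :: "rules \<Rightarrow> deriv \<Rightarrow> bool" where
  "built_by R (Infer S ds) \<longleftrightarrow> R (map end_sequent ds) S \<and> (\<forall>d\<in>set ds. built_by R d)"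

definition derivation :: "calculus \<Rightarrow> deriv \<Rightarrow> bool" where
  "derivation c d \<longleftrightarrow> built_by (calculus_rule c) d \<and> (\<forall>S\<in>sequents d. in_language c S)"

definition cut_free_derivation :: "calculus \<Rightarrow> deriv \<Rightarrow> bool" where
  "cut_free_derivation c d \<longleftrightarrow> built_by (noncut_rule c) d \<and> (\<forall>S\<in>sequents d. in_language c S)"

definition derivable :: "calculus \<Rightarrow> sequent \<Rightarrow> bool" where
  "derivable c S \<longleftrightarrow> (\<exists>d. derivation c d \<and> end_sequent d = S)"

end

theory Submission
  imports Defs
begin

text \<open>
  The proof follows Belnap's argument for display calculi. A cut on a formula \<open>F\<close> is moved
  to the places where \<open>F\<close> is introduced by a substitution, instead of permuting it upwards one
  inference at a time.
  In a cut-free derivation of \<open>F \<turnstile> Y\<close>, the ancestors of the displayed \<open>F\<close> all lie in antecedent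
  position, because every rule lists its structure variables with the same polarity in premises
  and conclusion; so all of them can be overwritten by the left premise's antecedent \<open>X\<close>, and
  each rule remains an instance of itself. The only inferences that break are those in which
  \<open>F\<close> is principal, and there \<open>F\<close> is the whole antecedent: what is needed at such a place is
  \<open>X \<turnstile> Y'\<close>, a cut whose right premise has just been introduced by the left rule of \<open>F\<close>. The same
  substitution on the other side, in the derivation of \<open>X \<turnstile> F\<close>, reduces this to cuts in which
  \<open>F\<close> is principal in both premises (\<open>cut_free_repl\<close>, used twice in \<open>cut_elimination_step\<close>).

  A cut that is principal on both sides is reduced to cuts on immediate subformulas by the
  display rules (\<open>principal_cutD\<close>, \<open>principal_cutI\<close>, \<open>principal_cutC\<close>). For the heterogeneous
  connectives \<open>CircI\<close> and \<open>CircC\<close> the decisive rules are the ones that let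
  \<open>SDiaI X \<turnstile>\<^sub>I SBoxI Y\<close>, respectively \<open>SDiaC X \<turnstile>\<^sub>C SBoxC Y\<close>, conclude \<open>X \<turnstile>\<^sub>D Y\<close>; for the three
  negations they are the Galois rules and contraposition. Cut admissibility follows by
  induction on the size of the cut formula.

  The rules that D.IA1, D.IA2 and D.IA3 add are purely structural, so they take part in the
  argument solely through their stability under substitution, which makes the six calculi one
  case.

  The language restriction of D.TQBA is dealt with separately. Every rule other than cut
  carries all the material of its premises, up to passing to immediate subformulas, into its
  conclusion. Read upwards, this gives the subformula property, and it also shows that a
  cut-free derivation never leaves the language of its end-sequent.
\<close>

section \<open>Substituting a structure for occurrences of a formula\<close>

datatype replacement = RepD fD sD | RepI fI sI | RepC fC sC

text \<open>
  \<open>replD b0 r b X X'\<close>: the structure \<open>X\<close>, itself in antecedent (\<open>b = True\<close>) or succedent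
  position, becomes \<open>X'\<close> when some of the occurrences of the formula of \<open>r\<close> that have polarity
  \<open>b0\<close> are overwritten. Occurrences to be overwritten are chosen freely, which is why this is
  a relation: the ancestors of one occurrence must be replaced without touching other
  occurrences of the same formula. The polarity \<open>b\<close> flips under negations and in the first
  argument of implications and co-implications.
\<close>
primrec replD :: "bool \<Rightarrow> replacement \<Rightarrow> bool \<Rightarrow> sD \<Rightarrow> sD \<Rightarrow> bool"
  and replI :: "bool \<Rightarrow> replacement \<Rightarrow> bool \<Rightarrow> sI \<Rightarrow> sI \<Rightarrow> bool"
  and replC :: "bool \<Rightarrow> replacement \<Rightarrow> bool \<Rightarrow> sC \<Rightarrow> sC \<Rightarrow> bool" where
  "replD b0 r b (FmD A) Z = (Z = FmD A \<or> b = b0 \<and> r = RepD A Z)"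
| "replD b0 r b SBot Z = (Z = SBot)"
| "replD b0 r b STop Z = (Z = STop)"
| "replD b0 r b (SCircC X) Z = (\<exists>X'. Z = SCircC X' \<and> replC b0 r b X X')"
| "replD b0 r b (SCircI X) Z = (\<exists>X'. Z = SCircI X' \<and> replI b0 r b X X')"
| "replD b0 r b (SNeg X) Z = (\<exists>X'. Z = SNeg X' \<and> replD b0 r (\<not> b) X X')"
| "replD b0 r b (X \<^bold>\<and> Y) Z = (\<exists>X' Y'. Z = X' \<^bold>\<and> Y' \<and> replD b0 r b X X' \<and> replD b0 r b Y Y')"
| "replD b0 r b (X \<^bold>\<or> Y) Z = (\<exists>X' Y'. Z = X' \<^bold>\<or> Y' \<and> replD b0 r b X X' \<and> replD b0 r b Y Y')"
| "replD b0 r b (X \<^bold>\<succ> Y) Z = (\<exists>X' Y'. Z = X' \<^bold>\<succ> Y' \<and> replD b0 r (\<not> b) X X' \<and> replD b0 r b Y Y')"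
| "replD b0 r b (X \<^bold>\<rightarrow> Y) Z = (\<exists>X' Y'. Z = X' \<^bold>\<rightarrow> Y' \<and> replD b0 r (\<not> b) X X' \<and> replD b0 r b Y Y')"
| "replI b0 r b (FmI A) Z = (Z = FmI A \<or> b = b0 \<and> r = RepI A Z)"
| "replI b0 r b SZeroI Z = (Z = SZeroI)"
| "replI b0 r b SOneI Z = (Z = SOneI)"
| "replI b0 r b (SBoxI X) Z = (\<exists>X'. Z = SBoxI X' \<and> replD b0 r b X X')"
| "replI b0 r b (SDiaI X) Z = (\<exists>X'. Z = SDiaI X' \<and> replD b0 r b X X')"
| "replI b0 r b (SSim X) Z = (\<exists>X'. Z = SSim X' \<and> replI b0 r (\<not> b) X X')"
| "replI b0 r b (X \<^bold>\<inter> Y) Z = (\<exists>X' Y'. Z = X' \<^bold>\<inter> Y' \<and> replI b0 r b X X' \<and> replI b0 r b Y Y')"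
| "replI b0 r b (X \<^bold>\<union> Y) Z = (\<exists>X' Y'. Z = X' \<^bold>\<union> Y' \<and> replI b0 r b X X' \<and> replI b0 r b Y Y')"
| "replI b0 r b (X \<^bold>\<succ>\<^sub>I Y) Z = (\<exists>X' Y'. Z = X' \<^bold>\<succ>\<^sub>I Y' \<and> replI b0 r (\<not> b) X X' \<and> replI b0 r b Y Y')"
| "replI b0 r b (X \<^bold>\<rightarrow>\<^sub>I Y) Z = (\<exists>X' Y'. Z = X' \<^bold>\<rightarrow>\<^sub>I Y' \<and> replI b0 r (\<not> b) X X' \<and> replI b0 r b Y Y')"
| "replC b0 r b (FmC A) Z = (Z = FmC A \<or> b = b0 \<and> r = RepC A Z)"
| "replC b0 r b SZeroC Z = (Z = SZeroC)"
| "replC b0 r b SOneC Z = (Z = SOneC)"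
| "replC b0 r b (SBoxC X) Z = (\<exists>X'. Z = SBoxC X' \<and> replD b0 r b X X')"
| "replC b0 r b (SDiaC X) Z = (\<exists>X'. Z = SDiaC X' \<and> replD b0 r b X X')"
| "replC b0 r b (SMinus X) Z = (\<exists>X'. Z = SMinus X' \<and> replC b0 r (\<not> b) X X')"
| "replC b0 r b (X \<^bold>\<sqinter> Y) Z = (\<exists>X' Y'. Z = X' \<^bold>\<sqinter> Y' \<and> replC b0 r b X X' \<and> replC b0 r b Y Y')"
| "replC b0 r b (X \<^bold>\<squnion> Y) Z = (\<exists>X' Y'. Z = X' \<^bold>\<squnion> Y' \<and> replC b0 r b X X' \<and> replC b0 r b Y Y')"
| "replC b0 r b (X \<^bold>\<succ>\<^sub>C Y) Z = (\<exists>X' Y'. Z = X' \<^bold>\<succ>\<^sub>C Y' \<and> replC b0 r (\<not> b) X X' \<and> replC b0 r b Y Y')"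
| "replC b0 r b (X \<^bold>\<rightarrow>\<^sub>C Y) Z = (\<exists>X' Y'. Z = X' \<^bold>\<rightarrow>\<^sub>C Y' \<and> replC b0 r (\<not> b) X X' \<and> replC b0 r b Y Y')"

primrec repl_seq :: "bool \<Rightarrow> replacement \<Rightarrow> sequent \<Rightarrow> sequent \<Rightarrow> bool" where
  "repl_seq b0 r (X \<turnstile>\<^sub>D Y) S = (\<exists>X' Y'. S = (X' \<turnstile>\<^sub>D Y') \<and> replD b0 r True X X' \<and> replD b0 r False Y Y')"
| "repl_seq b0 r (G \<turnstile>\<^sub>I H) S = (\<exists>G' H'. S = (G' \<turnstile>\<^sub>I H') \<and> replI b0 r True G G' \<and> replI b0 r False H H')"
| "repl_seq b0 r (P \<turnstile>\<^sub>C Q) S = (\<exists>P' Q'. S = (P' \<turnstile>\<^sub>C Q') \<and> replC b0 r True P P' \<and> replC b0 r False Q Q')"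

lemma repl_refl:
  "replD b0 r b X X"
  "replI b0 r b G G"
  "replC b0 r b P P"
  by (induction X and G and P arbitrary: b and b and b) auto

text \<open>
  Stability of the two-way rules under substitution, in either direction. The proofs only need
  to observe that each structure variable keeps its polarity and that no rule of this kind
  mentions a formula, so a substitution on one side determines one on the other.
\<close>
lemma tqba_inv_down:
  assumes "tqba_inv S T" and "repl_seq b r T T'"
  shows "\<exists>S'. repl_seq b r S S' \<and> tqba_inv S' T'"
  using assms by cases (clarsimp, rule exI, rule conjI[rotated], rule tqba_inv.intros, (simp; fail))+

lemma tqba_inv_up:
  assumes "tqba_inv S T" and "repl_seq b r S S'"
  shows "\<exists>T'. repl_seq b r T T' \<and> tqba_inv S' T'"
  using assms by cases (clarsimp, rule exI, rule conjI[rotated], rule tqba_inv.intros, (simp; fail))+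

section \<open>Principal occurrences\<close>

text \<open>
  \<open>left_principalD P A Y\<close> says that \<open>A \<turnstile> Y\<close> is the conclusion of an inference with principal
  formula \<open>A\<close> whose premises satisfy \<open>P\<close>. The premises are spelled out per connective so that
  principal cuts can be analysed by cases on the formula alone. An atom is principal in the
  identity axiom.
\<close>
fun left_principalD :: "(sequent \<Rightarrow> bool) \<Rightarrow> fD \<Rightarrow> sD \<Rightarrow> bool" where
  "left_principalD P (PVar p) Y = (Y = FmD (PVar p))"
| "left_principalD P TopD Y = P (STop \<turnstile>\<^sub>D Y)"
| "left_principalD P BotD Y = (Y = SBot)"
| "left_principalD P (CircI a) Y = P (SCircI (FmI a) \<turnstile>\<^sub>D Y)"
| "left_principalD P (CircC x) Y = P (SCircC (FmC x) \<turnstile>\<^sub>D Y)"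
| "left_principalD P (NegD A) Y = P (SNeg (FmD A) \<turnstile>\<^sub>D Y)"
| "left_principalD P (AndD A B) Y = P (FmD A \<^bold>\<and> FmD B \<turnstile>\<^sub>D Y)"
| "left_principalD P (OrD A B) Y =
    (\<exists>Y1 Y2. Y = Y1 \<^bold>\<or> Y2 \<and> P (FmD A \<turnstile>\<^sub>D Y1) \<and> P (FmD B \<turnstile>\<^sub>D Y2))"

fun left_principalI :: "(sequent \<Rightarrow> bool) \<Rightarrow> fI \<Rightarrow> sI \<Rightarrow> bool" where
  "left_principalI P (BoxI A) H = (\<exists>Y. H = SBoxI Y \<and> P (FmD A \<turnstile>\<^sub>D Y))"
| "left_principalI P OneI H = P (SOneI \<turnstile>\<^sub>I H)"
| "left_principalI P ZeroI H = (H = SZeroI)"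
| "left_principalI P (CapI a b) H = P (FmI a \<^bold>\<inter> FmI b \<turnstile>\<^sub>I H)"
| "left_principalI P (CupI a b) H =
    (\<exists>H1 H2. H = H1 \<^bold>\<union> H2 \<and> P (FmI a \<turnstile>\<^sub>I H1) \<and> P (FmI b \<turnstile>\<^sub>I H2))"
| "left_principalI P (Sim a) H = P (SSim (FmI a) \<turnstile>\<^sub>I H)"

fun left_principalC :: "(sequent \<Rightarrow> bool) \<Rightarrow> fC \<Rightarrow> sC \<Rightarrow> bool" where
  "left_principalC P (DiaC A) S = P (SDiaC (FmD A) \<turnstile>\<^sub>C S)"
| "left_principalC P OneC S = P (SOneC \<turnstile>\<^sub>C S)"
| "left_principalC P ZeroC S = (S = SZeroC)"
| "left_principalC P (CapC x y) S = P (FmC x \<^bold>\<sqinter> FmC y \<turnstile>\<^sub>C S)"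
| "left_principalC P (CupC x y) S =
    (\<exists>S1 S2. S = S1 \<^bold>\<squnion> S2 \<and> P (FmC x \<turnstile>\<^sub>C S1) \<and> P (FmC y \<turnstile>\<^sub>C S2))"
| "left_principalC P (Minus x) S = P (SMinus (FmC x) \<turnstile>\<^sub>C S)"

fun right_principalD :: "(sequent \<Rightarrow> bool) \<Rightarrow> fD \<Rightarrow> sD \<Rightarrow> bool" where
  "right_principalD P (PVar p) X = (X = FmD (PVar p))"
| "right_principalD P TopD X = (X = STop)"
| "right_principalD P BotD X = P (X \<turnstile>\<^sub>D SBot)"
| "right_principalD P (CircI a) X = P (X \<turnstile>\<^sub>D SCircI (FmI a))"
| "right_principalD P (CircC x) X = P (X \<turnstile>\<^sub>D SCircC (FmC x))"
| "right_principalD P (NegD A) X = P (X \<turnstile>\<^sub>D SNeg (FmD A))"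
| "right_principalD P (AndD A B) X =
    (\<exists>X1 X2. X = X1 \<^bold>\<and> X2 \<and> P (X1 \<turnstile>\<^sub>D FmD A) \<and> P (X2 \<turnstile>\<^sub>D FmD B))"
| "right_principalD P (OrD A B) X = P (X \<turnstile>\<^sub>D FmD A \<^bold>\<or> FmD B)"

fun right_principalI :: "(sequent \<Rightarrow> bool) \<Rightarrow> fI \<Rightarrow> sI \<Rightarrow> bool" where
  "right_principalI P (BoxI A) G = P (G \<turnstile>\<^sub>I SBoxI (FmD A))"
| "right_principalI P OneI G = (G = SOneI)"
| "right_principalI P ZeroI G = P (G \<turnstile>\<^sub>I SZeroI)"
| "right_principalI P (CapI a b) G =
    (\<exists>G1 G2. G = G1 \<^bold>\<inter> G2 \<and> P (G1 \<turnstile>\<^sub>I FmI a) \<and> P (G2 \<turnstile>\<^sub>I FmI b))"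
| "right_principalI P (CupI a b) G = P (G \<turnstile>\<^sub>I FmI a \<^bold>\<union> FmI b)"
| "right_principalI P (Sim a) G = P (G \<turnstile>\<^sub>I SSim (FmI a))"

fun right_principalC :: "(sequent \<Rightarrow> bool) \<Rightarrow> fC \<Rightarrow> sC \<Rightarrow> bool" where
  "right_principalC P (DiaC A) T = (\<exists>X. T = SDiaC X \<and> P (X \<turnstile>\<^sub>D FmD A))"
| "right_principalC P OneC T = (T = SOneC)"
| "right_principalC P ZeroC T = P (T \<turnstile>\<^sub>C SZeroC)"
| "right_principalC P (CapC x y) T =
    (\<exists>T1 T2. T = T1 \<^bold>\<sqinter> T2 \<and> P (T1 \<turnstile>\<^sub>C FmC x) \<and> P (T2 \<turnstile>\<^sub>C FmC y))"
| "right_principalC P (CupC x y) T = P (T \<turnstile>\<^sub>C FmC x \<^bold>\<squnion> FmC y)"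
| "right_principalC P (Minus x) T = P (T \<turnstile>\<^sub>C SMinus (FmC x))"

text \<open>
  The cuts that remain after a substitution of \<open>r\<close> has reached the inferences introducing its
  formula: for \<open>True\<close> (antecedent occurrences) the formula is principal on the left of the right
  premise, and the structure of \<open>r\<close> is the antecedent of the left premise; for \<open>False\<close> dually.
\<close>
fun principal_cuts :: "(sequent \<Rightarrow> bool) \<Rightarrow> bool \<Rightarrow> replacement \<Rightarrow> bool" where
  "principal_cuts P True (RepD A U) = (\<forall>Y. left_principalD P A Y \<longrightarrow> P (U \<turnstile>\<^sub>D Y))"
| "principal_cuts P True (RepI a U) = (\<forall>H. left_principalI P a H \<longrightarrow> P (U \<turnstile>\<^sub>I H))"
| "principal_cuts P True (RepC x U) = (\<forall>S. left_principalC P x S \<longrightarrow> P (U \<turnstile>\<^sub>C S))"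
| "principal_cuts P False (RepD A U) = (\<forall>X. right_principalD P A X \<longrightarrow> P (X \<turnstile>\<^sub>D U))"
| "principal_cuts P False (RepI a U) = (\<forall>G. right_principalI P a G \<longrightarrow> P (G \<turnstile>\<^sub>I U))"
| "principal_cuts P False (RepC x U) = (\<forall>T. right_principalC P x T \<longrightarrow> P (T \<turnstile>\<^sub>C U))"

definition closed_under :: "rules \<Rightarrow> (sequent \<Rightarrow> bool) \<Rightarrow> bool" where
  "closed_under R P \<longleftrightarrow> (\<forall>Ps S. R Ps S \<longrightarrow> (\<forall>Q\<in>set Ps. P Q) \<longrightarrow> P S)"

lemma closed_underD: "closed_under R P \<Longrightarrow> R Ps S \<Longrightarrow> \<forall>Q\<in>set Ps. P Q \<Longrightarrow> P S"
  by (auto simp: closed_under_def)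

text \<open>
  If premises may be rewritten, so may the conclusion. For structural rules the rewritten
  conclusion is again an instance of the same rule. For an operational rule the principal
  formula is displayed, so either it is kept, and the rule applies again, or it is overwritten,
  and the resulting sequent is provided by \<open>principal_cuts\<close>. As only one polarity is overwritten, an
  identity axiom never loses both of its formulas.
\<close>
lemma tqba_rule_repl:
  assumes "tqba_rule Ps S" and cl: "closed_under tqba_rule P" and "principal_cuts P b r"
    and "\<forall>Q\<in>set Ps. \<forall>Q'. repl_seq b r Q Q' \<longrightarrow> P Q'" and "repl_seq b r S S'"
  shows "P S'"
  using assms(1)
proof cases
  case (down T)
  with assms tqba_inv_down[of T S b r S'] show ?thesis
    by (metis closed_underD[OF cl tqba_rule.down] list.set_intros(1) empty_iff list.set(1) set_ConsD)
next
  case (up T)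
  with assms tqba_inv_up[of S T b r S'] show ?thesis
    by (metis closed_underD[OF cl tqba_rule.up] list.set_intros(1) empty_iff list.set(1) set_ConsD)
qed (insert assms(3-),
  (clarsimp; (elim disjE)?; clarsimp?;
   ((rule closed_underD[OF cl], rule tqba_rule.intros, (simp; fail)) | (simp; fail)))+)

lemma tqba5_inv_down:
  assumes "tqba5_inv S T" and "repl_seq b r T T'"
  shows "\<exists>S'. repl_seq b r S S' \<and> tqba5_inv S' T'"
  using assms by cases (clarsimp, rule exI, rule conjI[rotated], rule tqba5_inv.intros, (simp; fail))+

lemma tqba5_inv_up:
  assumes "tqba5_inv S T" and "repl_seq b r S S'"
  shows "\<exists>T'. repl_seq b r T T' \<and> tqba5_inv S' T'"
  using assms by cases (clarsimp, rule exI, rule conjI[rotated], rule tqba5_inv.intros, (simp; fail))+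

lemma tqba5_rule_repl:
  assumes "tqba5_rule Ps S" and cl: "closed_under tqba5_rule P" and "principal_cuts P b r"
    and "\<forall>Q\<in>set Ps. \<forall>Q'. repl_seq b r Q Q' \<longrightarrow> P Q'" and "repl_seq b r S S'"
  shows "P S'"
  using assms(1)
proof cases
  case (down T)
  with assms tqba5_inv_down[of T S b r S'] show ?thesis
    by (metis closed_underD[OF cl tqba5_rule.down] list.set_intros(1) empty_iff list.set(1) set_ConsD)
next
  case (up T)
  with assms tqba5_inv_up[of S T b r S'] show ?thesis
    by (metis closed_underD[OF cl tqba5_rule.up] list.set_intros(1) empty_iff list.set(1) set_ConsD)
qed (insert assms(3-),
  (clarsimp; (elim disjE)?; clarsimp?;
   ((rule closed_underD[OF cl], rule tqba5_rule.intros, (simp; fail)) | (simp; fail)))+)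

lemma ia1_rule_repl:
  assumes "ia1_rule Ps S" and cl: "closed_under ia1_rule P"
    and "\<forall>Q\<in>set Ps. \<forall>Q'. repl_seq b r Q Q' \<longrightarrow> P Q'" and "repl_seq b r S S'"
  shows "P S'"
  using assms(1) by cases (insert assms(3-),
    (clarsimp, rule closed_underD[OF cl], rule ia1_rule.intros, (simp; fail))+)

lemma ia2_rule_repl:
  assumes "ia2_rule Ps S" and cl: "closed_under ia2_rule P"
    and "\<forall>Q\<in>set Ps. \<forall>Q'. repl_seq b r Q Q' \<longrightarrow> P Q'" and "repl_seq b r S S'"
  shows "P S'"
  using assms(1) by cases (insert assms(3-),
    (clarsimp, rule closed_underD[OF cl], rule ia2_rule.intros, (simp; fail))+)

lemma ia3_rule_repl:
  assumes "ia3_rule Ps S" and cl: "closed_under ia3_rule P"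
    and "\<forall>Q\<in>set Ps. \<forall>Q'. repl_seq b r Q Q' \<longrightarrow> P Q'" and "repl_seq b r S S'"
  shows "P S'"
  using assms(1) by cases (insert assms(3-),
    (clarsimp, rule closed_underD[OF cl], rule ia3_rule.intros, (simp; fail))+)

section \<open>Substitution in cut-free derivations\<close>

text \<open>
  Derivability without cut, disregarding the language restriction; \<open>built_by_in_language\<close>
  restores it once the derivation has been found.
\<close>
inductive cut_free :: "calculus \<Rightarrow> sequent \<Rightarrow> bool" for c where
  infer: "noncut_rule c Ps S \<Longrightarrow> \<forall>Q\<in>set Ps. cut_free c Q \<Longrightarrow> cut_free c S"

lemma closed_under_cut_free:
  assumes "\<And>Ps S. R Ps S \<Longrightarrow> noncut_rule c Ps S"
  shows "closed_under R (cut_free c)"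
  using assms by (auto simp: closed_under_def intro: infer)

lemma closed_under_tqba: "closed_under tqba_rule (cut_free c)"
  by (rule closed_under_cut_free) (cases c; simp)

lemma closed_under_tqba5: "c \<noteq> TQBA \<Longrightarrow> closed_under tqba5_rule (cut_free c)"
  by (rule closed_under_cut_free) (cases c; simp)

text \<open>
  The parametric part of cut elimination, for both sides at once: the cut is carried to
  all places where the ancestors of the cut formula were introduced.
\<close>
lemma cut_free_repl:
  assumes "cut_free c S" and "principal_cuts (cut_free c) b r" and "repl_seq b r S S'"
  shows "cut_free c S'"
  using assms(1,3)
proof (induction arbitrary: S')
  case (infer Ps S)
  note IH = \<open>\<forall>Q\<in>set Ps. _ Q\<close>
  have prem: "\<forall>Q\<in>set Ps. \<forall>Q'. repl_seq b r Q Q' \<longrightarrow> cut_free c Q'"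
    using IH by blast
  consider "tqba_rule Ps S" | "c \<noteq> TQBA" "tqba5_rule Ps S"
    | "c = IA1 \<or> c = PRA" "ia1_rule Ps S" | "c = IA2 \<or> c = PRA" "ia2_rule Ps S"
    | "c = IA3 \<or> c = PRA" "ia3_rule Ps S"
    using infer.hyps by (cases c) auto
  then show ?case
  proof cases
    case 1
    then show ?thesis
      using tqba_rule_repl[OF _ closed_under_tqba assms(2) prem infer.prems] by blast
  next
    case 2
    then show ?thesis
      using tqba5_rule_repl[OF _ closed_under_tqba5 assms(2) prem infer.prems] by blast
  next
    case 3
    then have "closed_under ia1_rule (cut_free c)"
      by (intro closed_under_cut_free) auto
    with 3 show ?thesis
      using ia1_rule_repl[OF _ _ prem infer.prems] by blast
  next
    case 4
    then have "closed_under ia2_rule (cut_free c)"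
      by (intro closed_under_cut_free) auto
    with 4 show ?thesis
      using ia2_rule_repl[OF _ _ prem infer.prems] by blast
  next
    case 5
    then have "closed_under ia3_rule (cut_free c)"
      by (intro closed_under_cut_free) auto
    with 5 show ?thesis
      using ia3_rule_repl[OF _ _ prem infer.prems] by blast
  qed
qed

section \<open>Principal cuts\<close>
fun cut_admissible :: "(sequent \<Rightarrow> bool) \<Rightarrow> fm \<Rightarrow> bool" where
  "cut_admissible P (InD A) =
    (\<forall>X Y. P (X \<turnstile>\<^sub>D FmD A) \<longrightarrow> P (FmD A \<turnstile>\<^sub>D Y) \<longrightarrow> P (X \<turnstile>\<^sub>D Y))"
| "cut_admissible P (InI a) =
    (\<forall>G H. P (G \<turnstile>\<^sub>I FmI a) \<longrightarrow> P (FmI a \<turnstile>\<^sub>I H) \<longrightarrow> P (G \<turnstile>\<^sub>I H))"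
| "cut_admissible P (InC x) =
    (\<forall>T S. P (T \<turnstile>\<^sub>C FmC x) \<longrightarrow> P (FmC x \<turnstile>\<^sub>C S) \<longrightarrow> P (T \<turnstile>\<^sub>C S))"

text \<open>
  Unfolded in the simplifier, admissibility of a cut is a conditional rewrite rule with itself
  as a condition.
\<close>
declare cut_admissible.simps [simp del]

lemma cut_admissibleD:
  "cut_admissible P (InD A) \<Longrightarrow> P (X \<turnstile>\<^sub>D FmD A) \<Longrightarrow> P (FmD A \<turnstile>\<^sub>D Y) \<Longrightarrow> P (X \<turnstile>\<^sub>D Y)"
  "cut_admissible P (InI a) \<Longrightarrow> P (G \<turnstile>\<^sub>I FmI a) \<Longrightarrow> P (FmI a \<turnstile>\<^sub>I H) \<Longrightarrow> P (G \<turnstile>\<^sub>I H)"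
  "cut_admissible P (InC x) \<Longrightarrow> P (T \<turnstile>\<^sub>C FmC x) \<Longrightarrow> P (FmC x \<turnstile>\<^sub>C S) \<Longrightarrow> P (T \<turnstile>\<^sub>C S)"
  unfolding cut_admissible.simps by blast+

lemma tqba_inv_iff:
  assumes "closed_under tqba_rule P" and "tqba_inv S T"
  shows "P S \<longleftrightarrow> P T"
  using closed_underD[OF assms(1) tqba_rule.down[OF assms(2)]]
    closed_underD[OF assms(1) tqba_rule.up[OF assms(2)]] by auto

lemma tqba5_inv_iff:
  assumes "closed_under tqba5_rule P" and "tqba5_inv S T"
  shows "P S \<longleftrightarrow> P T"
  using closed_underD[OF assms(1) tqba5_rule.down[OF assms(2)]]
    closed_underD[OF assms(1) tqba5_rule.up[OF assms(2)]] by auto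

text \<open>
  The conjuncts are cut one after the other: residuation isolates the conjunct to be cut as the
  whole antecedent, parking the other one on the right under the structural implication.
  Residuation moves the first component only, so commutativity is needed in between. The
  disjunctions, and the connectives of the kernel types, behave in the same way.
\<close>
lemma conj_cutD:
  assumes cl: "closed_under tqba_rule P"
    and cuts: "cut_admissible P (InD A)" "cut_admissible P (InD B)"
    and "P (X1 \<turnstile>\<^sub>D FmD A)" "P (X2 \<turnstile>\<^sub>D FmD B)" "P (FmD A \<^bold>\<and> FmD B \<turnstile>\<^sub>D Y)"
  shows "P (X1 \<^bold>\<and> X2 \<turnstile>\<^sub>D Y)"
proof -
  note display = tqba_inv_iff[OF cl res_andD]
  have comm: "P (V \<^bold>\<and> U \<turnstile>\<^sub>D Y)" if "P (U \<^bold>\<and> V \<turnstile>\<^sub>D Y)" for U V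
    using closed_underD[OF cl tqba_rule.commLD] that by simp
  have "P (FmD B \<turnstile>\<^sub>D FmD A \<^bold>\<rightarrow> Y)"
    using assms(6) display by simp
  with cuts(2) assms(5) have "P (X2 \<turnstile>\<^sub>D FmD A \<^bold>\<rightarrow> Y)"
    by (rule cut_admissibleD)
  then have "P (X2 \<^bold>\<and> FmD A \<turnstile>\<^sub>D Y)"
    by - (rule comm, simp add: display)
  then have "P (FmD A \<turnstile>\<^sub>D X2 \<^bold>\<rightarrow> Y)"
    using display by simp
  with cuts(1) assms(4) have "P (X1 \<turnstile>\<^sub>D X2 \<^bold>\<rightarrow> Y)"
    by (rule cut_admissibleD)
  then show ?thesis
    by - (rule comm, simp add: display)
qed

lemma disj_cutD:
  assumes cl: "closed_under tqba_rule P"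
    and cuts: "cut_admissible P (InD A)" "cut_admissible P (InD B)"
    and "P (FmD A \<turnstile>\<^sub>D Y1)" "P (FmD B \<turnstile>\<^sub>D Y2)" "P (X \<turnstile>\<^sub>D FmD A \<^bold>\<or> FmD B)"
  shows "P (X \<turnstile>\<^sub>D Y1 \<^bold>\<or> Y2)"
proof -
  note display = tqba_inv_iff[OF cl res_orD, symmetric]
  have comm: "P (X \<turnstile>\<^sub>D V \<^bold>\<or> U)" if "P (X \<turnstile>\<^sub>D U \<^bold>\<or> V)" for U V
    using closed_underD[OF cl tqba_rule.commRD] that by simp
  have "P (FmD A \<^bold>\<succ> X \<turnstile>\<^sub>D FmD B)"
    using assms(6) display by simp
  from cuts(2) this assms(5) have "P (FmD A \<^bold>\<succ> X \<turnstile>\<^sub>D Y2)"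
    by (rule cut_admissibleD)
  then have "P (X \<turnstile>\<^sub>D Y2 \<^bold>\<or> FmD A)"
    by - (rule comm, simp add: display)
  then have "P (Y2 \<^bold>\<succ> X \<turnstile>\<^sub>D FmD A)"
    using display by simp
  from cuts(1) this assms(4) have "P (Y2 \<^bold>\<succ> X \<turnstile>\<^sub>D Y1)"
    by (rule cut_admissibleD)
  then show ?thesis
    by - (rule comm, simp add: display)
qed

lemma conj_cutI:
  assumes cl: "closed_under tqba_rule P"
    and cuts: "cut_admissible P (InI a)" "cut_admissible P (InI b)"
    and "P (X1 \<turnstile>\<^sub>I FmI a)" "P (X2 \<turnstile>\<^sub>I FmI b)" "P (FmI a \<^bold>\<inter> FmI b \<turnstile>\<^sub>I Y)"
  shows "P (X1 \<^bold>\<inter> X2 \<turnstile>\<^sub>I Y)"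
proof -
  note display = tqba_inv_iff[OF cl res_andI]
  have comm: "P (V \<^bold>\<inter> U \<turnstile>\<^sub>I Y)" if "P (U \<^bold>\<inter> V \<turnstile>\<^sub>I Y)" for U V
    using closed_underD[OF cl tqba_rule.commLI] that by simp
  have "P (FmI b \<turnstile>\<^sub>I FmI a \<^bold>\<rightarrow>\<^sub>I Y)"
    using assms(6) display by simp
  with cuts(2) assms(5) have "P (X2 \<turnstile>\<^sub>I FmI a \<^bold>\<rightarrow>\<^sub>I Y)"
    by (rule cut_admissibleD)
  then have "P (X2 \<^bold>\<inter> FmI a \<turnstile>\<^sub>I Y)"
    by - (rule comm, simp add: display)
  then have "P (FmI a \<turnstile>\<^sub>I X2 \<^bold>\<rightarrow>\<^sub>I Y)"
    using display by simp
  with cuts(1) assms(4) have "P (X1 \<turnstile>\<^sub>I X2 \<^bold>\<rightarrow>\<^sub>I Y)"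
    by (rule cut_admissibleD)
  then show ?thesis
    by - (rule comm, simp add: display)
qed

lemma disj_cutI:
  assumes cl: "closed_under tqba_rule P"
    and cuts: "cut_admissible P (InI a)" "cut_admissible P (InI b)"
    and "P (FmI a \<turnstile>\<^sub>I Y1)" "P (FmI b \<turnstile>\<^sub>I Y2)" "P (X \<turnstile>\<^sub>I FmI a \<^bold>\<union> FmI b)"
  shows "P (X \<turnstile>\<^sub>I Y1 \<^bold>\<union> Y2)"
proof -
  note display = tqba_inv_iff[OF cl res_orI, symmetric]
  have comm: "P (X \<turnstile>\<^sub>I V \<^bold>\<union> U)" if "P (X \<turnstile>\<^sub>I U \<^bold>\<union> V)" for U V
    using closed_underD[OF cl tqba_rule.commRI] that by simp
  have "P (FmI a \<^bold>\<succ>\<^sub>I X \<turnstile>\<^sub>I FmI b)"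
    using assms(6) display by simp
  from cuts(2) this assms(5) have "P (FmI a \<^bold>\<succ>\<^sub>I X \<turnstile>\<^sub>I Y2)"
    by (rule cut_admissibleD)
  then have "P (X \<turnstile>\<^sub>I Y2 \<^bold>\<union> FmI a)"
    by - (rule comm, simp add: display)
  then have "P (Y2 \<^bold>\<succ>\<^sub>I X \<turnstile>\<^sub>I FmI a)"
    using display by simp
  from cuts(1) this assms(4) have "P (Y2 \<^bold>\<succ>\<^sub>I X \<turnstile>\<^sub>I Y1)"
    by (rule cut_admissibleD)
  then show ?thesis
    by - (rule comm, simp add: display)
qed

lemma conj_cutC:
  assumes cl: "closed_under tqba_rule P"
    and cuts: "cut_admissible P (InC x)" "cut_admissible P (InC y)"
    and "P (X1 \<turnstile>\<^sub>C FmC x)" "P (X2 \<turnstile>\<^sub>C FmC y)" "P (FmC x \<^bold>\<sqinter> FmC y \<turnstile>\<^sub>C Y)"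
  shows "P (X1 \<^bold>\<sqinter> X2 \<turnstile>\<^sub>C Y)"
proof -
  note display = tqba_inv_iff[OF cl res_andC]
  have comm: "P (V \<^bold>\<sqinter> U \<turnstile>\<^sub>C Y)" if "P (U \<^bold>\<sqinter> V \<turnstile>\<^sub>C Y)" for U V
    using closed_underD[OF cl tqba_rule.commLC] that by simp
  have "P (FmC y \<turnstile>\<^sub>C FmC x \<^bold>\<rightarrow>\<^sub>C Y)"
    using assms(6) display by simp
  with cuts(2) assms(5) have "P (X2 \<turnstile>\<^sub>C FmC x \<^bold>\<rightarrow>\<^sub>C Y)"
    by (rule cut_admissibleD)
  then have "P (X2 \<^bold>\<sqinter> FmC x \<turnstile>\<^sub>C Y)"
    by - (rule comm, simp add: display)
  then have "P (FmC x \<turnstile>\<^sub>C X2 \<^bold>\<rightarrow>\<^sub>C Y)"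
    using display by simp
  with cuts(1) assms(4) have "P (X1 \<turnstile>\<^sub>C X2 \<^bold>\<rightarrow>\<^sub>C Y)"
    by (rule cut_admissibleD)
  then show ?thesis
    by - (rule comm, simp add: display)
qed

lemma disj_cutC:
  assumes cl: "closed_under tqba_rule P"
    and cuts: "cut_admissible P (InC x)" "cut_admissible P (InC y)"
    and "P (FmC x \<turnstile>\<^sub>C Y1)" "P (FmC y \<turnstile>\<^sub>C Y2)" "P (X \<turnstile>\<^sub>C FmC x \<^bold>\<squnion> FmC y)"
  shows "P (X \<turnstile>\<^sub>C Y1 \<^bold>\<squnion> Y2)"
proof -
  note display = tqba_inv_iff[OF cl res_orC, symmetric]
  have comm: "P (X \<turnstile>\<^sub>C V \<^bold>\<squnion> U)" if "P (X \<turnstile>\<^sub>C U \<^bold>\<squnion> V)" for U V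
    using closed_underD[OF cl tqba_rule.commRC] that by simp
  have "P (FmC x \<^bold>\<succ>\<^sub>C X \<turnstile>\<^sub>C FmC y)"
    using assms(6) display by simp
  from cuts(2) this assms(5) have "P (FmC x \<^bold>\<succ>\<^sub>C X \<turnstile>\<^sub>C Y2)"
    by (rule cut_admissibleD)
  then have "P (X \<turnstile>\<^sub>C Y2 \<^bold>\<squnion> FmC x)"
    by - (rule comm, simp add: display)
  then have "P (Y2 \<^bold>\<succ>\<^sub>C X \<turnstile>\<^sub>C FmC x)"
    using display by simp
  from cuts(1) this assms(4) have "P (Y2 \<^bold>\<succ>\<^sub>C X \<turnstile>\<^sub>C Y1)"
    by (rule cut_admissibleD)
  then show ?thesis
    by - (rule comm, simp add: display)
qed

text \<open>
  For compound formulas, display rules turn the premises of the two introductions into sequents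
  with the immediate subformulas displayed; these are cut, and then the display steps are
  undone.
\<close>
lemma principal_cutD:
  assumes cl: "closed_under tqba_rule P"
    and cuts: "\<And>B. imm_subfm B (InD A) \<Longrightarrow> cut_admissible P B"
    and "right_principalD P A X" and "left_principalD P A Y"
  shows "P (X \<turnstile>\<^sub>D Y)"
proof (cases A)
  case (PVar p)
  then show ?thesis
    using assms(3,4) closed_underD[OF cl tqba_rule.idp] by simp
next
  case TopD
  then show ?thesis using assms(3,4) by simp
next
  case BotD
  then show ?thesis using assms(3,4) by simp
next
  \<comment> \<open>The structural circle has a left and a right adjoint, so the subformula can be displayed
    on both sides; the two adjoints are cancelled by a rule that is not a display rule.\<close>
  case (CircI a)
  with cuts have "cut_admissible P (InI a)" by (simp add: imm_subfm.intros)
  moreover have "P (SDiaI X \<turnstile>\<^sub>I FmI a)" "P (FmI a \<turnstile>\<^sub>I SBoxI Y)"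
    using CircI assms(3,4) tqba_inv_iff[OF cl adj_diaI_circI] tqba_inv_iff[OF cl adj_circI_boxI]
    by simp_all
  ultimately have "P (SDiaI X \<turnstile>\<^sub>I SBoxI Y)"
    by (rule cut_admissibleD)
  then show ?thesis
    using closed_underD[OF cl dia_boxI] by simp
next
  case (CircC x)
  with cuts have "cut_admissible P (InC x)" by (simp add: imm_subfm.intros)
  moreover have "P (SDiaC X \<turnstile>\<^sub>C FmC x)" "P (FmC x \<turnstile>\<^sub>C SBoxC Y)"
    using CircC assms(3,4) tqba_inv_iff[OF cl adj_diaC_circC] tqba_inv_iff[OF cl adj_circC_boxC]
    by simp_all
  ultimately have "P (SDiaC X \<turnstile>\<^sub>C SBoxC Y)"
    by (rule cut_admissibleD)
  then show ?thesis
    using closed_underD[OF cl dia_boxC] by simp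
next
  case (NegD B)
  with cuts have "cut_admissible P (InD B)" by (simp add: imm_subfm.intros)
  moreover have "P (SNeg Y \<turnstile>\<^sub>D FmD B)" "P (FmD B \<turnstile>\<^sub>D SNeg X)"
    using NegD assms(3,4) tqba_inv_iff[OF cl gal_negR, of X] tqba_inv_iff[OF cl gal_negL, of _ Y]
    by simp_all
  ultimately have "P (SNeg Y \<turnstile>\<^sub>D SNeg X)"
    by (rule cut_admissibleD)
  then show ?thesis
    using tqba_inv_iff[OF cl contraposD, symmetric] by simp
next
  case (AndD B C)
  then obtain X1 X2 where "X = X1 \<^bold>\<and> X2" "P (X1 \<turnstile>\<^sub>D FmD B)" "P (X2 \<turnstile>\<^sub>D FmD C)"
    using assms(3) by auto
  moreover have "P (FmD B \<^bold>\<and> FmD C \<turnstile>\<^sub>D Y)"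
    using AndD assms(4) by simp
  moreover have "cut_admissible P (InD B)" "cut_admissible P (InD C)"
    using cuts AndD by (simp_all add: imm_subfm.intros)
  ultimately show ?thesis
    using conj_cutD[OF cl] by blast
next
  case (OrD B C)
  then obtain Y1 Y2 where "Y = Y1 \<^bold>\<or> Y2" "P (FmD B \<turnstile>\<^sub>D Y1)" "P (FmD C \<turnstile>\<^sub>D Y2)"
    using assms(4) by auto
  moreover have "P (X \<turnstile>\<^sub>D FmD B \<^bold>\<or> FmD C)"
    using OrD assms(3) by simp
  moreover have "cut_admissible P (InD B)" "cut_admissible P (InD C)"
    using cuts OrD by (simp_all add: imm_subfm.intros)
  ultimately show ?thesis
    using disj_cutD[OF cl] by blast
qed

text \<open>
  The reduction for \<open>Sim\<close> uses rules of D.TQBA5, hence the conditional closure assumption: cut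
  formulas of D.TQBA do not contain \<open>Sim\<close>, and there the condition is void.
\<close>
lemma principal_cutI:
  assumes cl: "closed_under tqba_rule P"
    and cl5: "(\<exists>b. a = Sim b) \<Longrightarrow> closed_under tqba5_rule P"
    and cuts: "\<And>B. imm_subfm B (InI a) \<Longrightarrow> cut_admissible P B"
    and "right_principalI P a G" and "left_principalI P a H"
  shows "P (G \<turnstile>\<^sub>I H)"
proof (cases a)
  case (BoxI A)
  then obtain Y where Y: "H = SBoxI Y" "P (FmD A \<turnstile>\<^sub>D Y)"
    using assms(5) by auto
  from BoxI cuts have "cut_admissible P (InD A)" by (simp add: imm_subfm.intros)
  moreover have "P (SCircI G \<turnstile>\<^sub>D FmD A)"
    using BoxI assms(4) tqba_inv_iff[OF cl adj_circI_boxI] by simp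
  moreover note Y(2)
  ultimately have "P (SCircI G \<turnstile>\<^sub>D Y)"
    by (rule cut_admissibleD)
  then show ?thesis
    using Y tqba_inv_iff[OF cl adj_circI_boxI] by simp
next
  case OneI
  then show ?thesis using assms(4,5) by simp
next
  case ZeroI
  then show ?thesis using assms(4,5) by simp
next
  case (CapI b d)
  then obtain G1 G2 where "G = G1 \<^bold>\<inter> G2" "P (G1 \<turnstile>\<^sub>I FmI b)" "P (G2 \<turnstile>\<^sub>I FmI d)"
    using assms(4) by auto
  moreover have "P (FmI b \<^bold>\<inter> FmI d \<turnstile>\<^sub>I H)"
    using CapI assms(5) by simp
  moreover have "cut_admissible P (InI b)" "cut_admissible P (InI d)"
    using cuts CapI by (simp_all add: imm_subfm.intros)
  ultimately show ?thesis
    using conj_cutI[OF cl] by blast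
next
  case (CupI b d)
  then obtain H1 H2 where "H = H1 \<^bold>\<union> H2" "P (FmI b \<turnstile>\<^sub>I H1)" "P (FmI d \<turnstile>\<^sub>I H2)"
    using assms(5) by auto
  moreover have "P (G \<turnstile>\<^sub>I FmI b \<^bold>\<union> FmI d)"
    using CupI assms(4) by simp
  moreover have "cut_admissible P (InI b)" "cut_admissible P (InI d)"
    using cuts CupI by (simp_all add: imm_subfm.intros)
  ultimately show ?thesis
    using disj_cutI[OF cl] by blast
next
  case (Sim b)
  then have cl5: "closed_under tqba5_rule P" using cl5 by simp
  from Sim cuts have "cut_admissible P (InI b)" by (simp add: imm_subfm.intros)
  moreover have "P (SSim H \<turnstile>\<^sub>I FmI b)" "P (FmI b \<turnstile>\<^sub>I SSim G)"
    using Sim assms(4,5) tqba5_inv_iff[OF cl5 gal_simR, of G] tqba5_inv_iff[OF cl5 gal_simL, of _ H]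
    by simp_all
  ultimately have "P (SSim H \<turnstile>\<^sub>I SSim G)"
    by (rule cut_admissibleD)
  then show ?thesis
    using tqba5_inv_iff[OF cl5 contraposI, symmetric] by simp
qed

lemma principal_cutC:
  assumes cl: "closed_under tqba_rule P"
    and cl5: "(\<exists>y. x = Minus y) \<Longrightarrow> closed_under tqba5_rule P"
    and cuts: "\<And>B. imm_subfm B (InC x) \<Longrightarrow> cut_admissible P B"
    and "right_principalC P x T" and "left_principalC P x S"
  shows "P (T \<turnstile>\<^sub>C S)"
proof (cases x)
  case (DiaC A)
  then obtain X where X: "T = SDiaC X" "P (X \<turnstile>\<^sub>D FmD A)"
    using assms(4) by auto
  from DiaC cuts have "cut_admissible P (InD A)" by (simp add: imm_subfm.intros)
  moreover note X(2)
  moreover have "P (FmD A \<turnstile>\<^sub>D SCircC S)"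
    using DiaC assms(5) tqba_inv_iff[OF cl adj_diaC_circC] by simp
  ultimately have "P (X \<turnstile>\<^sub>D SCircC S)"
    by (rule cut_admissibleD)
  then show ?thesis
    using X tqba_inv_iff[OF cl adj_diaC_circC] by simp
next
  case OneC
  then show ?thesis using assms(4,5) by simp
next
  case ZeroC
  then show ?thesis using assms(4,5) by simp
next
  case (CapC y z)
  then obtain T1 T2 where "T = T1 \<^bold>\<sqinter> T2" "P (T1 \<turnstile>\<^sub>C FmC y)" "P (T2 \<turnstile>\<^sub>C FmC z)"
    using assms(4) by auto
  moreover have "P (FmC y \<^bold>\<sqinter> FmC z \<turnstile>\<^sub>C S)"
    using CapC assms(5) by simp
  moreover have "cut_admissible P (InC y)" "cut_admissible P (InC z)"
    using cuts CapC by (simp_all add: imm_subfm.intros)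
  ultimately show ?thesis
    using conj_cutC[OF cl] by blast
next
  case (CupC y z)
  then obtain S1 S2 where "S = S1 \<^bold>\<squnion> S2" "P (FmC y \<turnstile>\<^sub>C S1)" "P (FmC z \<turnstile>\<^sub>C S2)"
    using assms(5) by auto
  moreover have "P (T \<turnstile>\<^sub>C FmC y \<^bold>\<squnion> FmC z)"
    using CupC assms(4) by simp
  moreover have "cut_admissible P (InC y)" "cut_admissible P (InC z)"
    using cuts CupC by (simp_all add: imm_subfm.intros)
  ultimately show ?thesis
    using disj_cutC[OF cl] by blast
next
  case (Minus y)
  then have cl5: "closed_under tqba5_rule P" using cl5 by simp
  from Minus cuts have "cut_admissible P (InC y)" by (simp add: imm_subfm.intros)
  moreover have "P (SMinus S \<turnstile>\<^sub>C FmC y)" "P (FmC y \<turnstile>\<^sub>C SMinus T)"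
    using Minus assms(4,5) tqba5_inv_iff[OF cl5 gal_minusR, of T]
      tqba5_inv_iff[OF cl5 gal_minusL, of _ S]
    by simp_all
  ultimately have "P (SMinus S \<turnstile>\<^sub>C SMinus T)"
    by (rule cut_admissibleD)
  then show ?thesis
    using tqba5_inv_iff[OF cl5 contraposC, symmetric] by simp
qed

section \<open>Admissibility of cut\<close>
primrec basic_fm :: "fm \<Rightarrow> bool" where
  "basic_fm (InD A) = basic_fD A"
| "basic_fm (InI a) = basic_fI a"
| "basic_fm (InC x) = basic_fC x"

lemma basic_imm_subfm: "imm_subfm A B \<Longrightarrow> basic_fm B \<Longrightarrow> basic_fm A"
  by (induction rule: imm_subfm.induct) auto

primrec fm_size :: "fm \<Rightarrow> nat" where
  "fm_size (InD A) = size A"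
| "fm_size (InI a) = size a"
| "fm_size (InC x) = size x"

lemma fm_size_imm_subfm: "imm_subfm A B \<Longrightarrow> fm_size A < fm_size B"
  by (induction rule: imm_subfm.induct) auto

text \<open>
  Two substitutions. The inner one works in the derivation of the left premise and is
  available for succedents \<open>Z\<close> against which \<open>F\<close> is principal on the left, since then both
  principal occurrences meet; the outer one works in the derivation of the right premise,
  where exactly these \<open>Z\<close> arise.
\<close>
lemma cut_elimination_step:
  assumes cuts: "\<And>B. imm_subfm B F \<Longrightarrow> cut_admissible (cut_free c) B"
    and basic: "c = TQBA \<longrightarrow> basic_fm F"
  shows "cut_admissible (cut_free c) F"
proof (cases F)
  case (InD A)
  have "cut_free c (X \<turnstile>\<^sub>D Y)"
    if R: "cut_free c (X \<turnstile>\<^sub>D FmD A)" and L: "cut_free c (FmD A \<turnstile>\<^sub>D Y)" for X Y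
  proof -
    have "cut_free c (X \<turnstile>\<^sub>D Z)" if "left_principalD (cut_free c) A Z" for Z
    proof -
      have "principal_cuts (cut_free c) False (RepD A Z)"
        using principal_cutD[OF closed_under_tqba cuts[unfolded InD] _ that] by simp
      then show ?thesis
        by (rule cut_free_repl[OF R]) (simp add: repl_refl)
    qed
    then have "principal_cuts (cut_free c) True (RepD A X)"
      by simp
    then show ?thesis
      by (rule cut_free_repl[OF L]) (simp add: repl_refl)
  qed
  then show ?thesis
    unfolding InD cut_admissible.simps by blast
next
  case (InI a)
  have cl5: "closed_under tqba5_rule (cut_free c)" if "\<exists>b. a = Sim b"
    using that basic InI closed_under_tqba5 by auto
  have "cut_free c (G \<turnstile>\<^sub>I H)"
    if R: "cut_free c (G \<turnstile>\<^sub>I FmI a)" and L: "cut_free c (FmI a \<turnstile>\<^sub>I H)" for G H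
  proof -
    have "cut_free c (G \<turnstile>\<^sub>I K)" if "left_principalI (cut_free c) a K" for K
    proof -
      have "principal_cuts (cut_free c) False (RepI a K)"
        using principal_cutI[OF closed_under_tqba cl5 cuts[unfolded InI] _ that] by simp
      then show ?thesis
        by (rule cut_free_repl[OF R]) (simp add: repl_refl)
    qed
    then have "principal_cuts (cut_free c) True (RepI a G)"
      by simp
    then show ?thesis
      by (rule cut_free_repl[OF L]) (simp add: repl_refl)
  qed
  then show ?thesis
    unfolding InI cut_admissible.simps by blast
next
  case (InC x)
  have cl5: "closed_under tqba5_rule (cut_free c)" if "\<exists>y. x = Minus y"
    using that basic InC closed_under_tqba5 by auto
  have "cut_free c (T \<turnstile>\<^sub>C S)"
    if R: "cut_free c (T \<turnstile>\<^sub>C FmC x)" and L: "cut_free c (FmC x \<turnstile>\<^sub>C S)" for T S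
  proof -
    have "cut_free c (T \<turnstile>\<^sub>C Q)" if "left_principalC (cut_free c) x Q" for Q
    proof -
      have "principal_cuts (cut_free c) False (RepC x Q)"
        using principal_cutC[OF closed_under_tqba cl5 cuts[unfolded InC] _ that] by simp
      then show ?thesis
        by (rule cut_free_repl[OF R]) (simp add: repl_refl)
    qed
    then have "principal_cuts (cut_free c) True (RepC x T)"
      by simp
    then show ?thesis
      by (rule cut_free_repl[OF L]) (simp add: repl_refl)
  qed
  then show ?thesis
    unfolding InC cut_admissible.simps by blast
qed

lemma cut_admissible_cut_free:
  "c = TQBA \<longrightarrow> basic_fm F \<Longrightarrow> cut_admissible (cut_free c) F"
proof (induction F rule: measure_induct_rule[of fm_size])
  case (less F)
  show ?case
  proof (rule cut_elimination_step)
    fix B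
    assume "imm_subfm B F"
    then show "cut_admissible (cut_free c) B"
      using less basic_imm_subfm fm_size_imm_subfm by blast
  qed (fact less.prems)
qed

lemma end_sequent_in_sequents: "end_sequent d \<in> sequents d"
  by (cases d) simp

text \<open>
  In D.TQBA the language condition on the premises makes the cut formula basic, so that
  its principal cuts can be reduced.
\<close>
lemma cut_rule_cut_free:
  assumes "cut_rule Ps S" and "\<forall>Q\<in>set Ps. cut_free c Q" and "\<forall>Q\<in>set Ps. in_language c Q"
  shows "cut_free c S"
  using assms(1)
proof cases
  case (cutD X A Y)
  then have "cut_admissible (cut_free c) (InD A)"
    by (intro cut_admissible_cut_free) (use assms(3) in \<open>simp add: in_language_def\<close>)
  then show ?thesis
    unfolding cutD by (rule cut_admissibleD) (use assms(2) cutD in simp_all)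
next
  case (cutI G a H)
  then have "cut_admissible (cut_free c) (InI a)"
    by (intro cut_admissible_cut_free) (use assms(3) in \<open>simp add: in_language_def\<close>)
  then show ?thesis
    unfolding cutI by (rule cut_admissibleD) (use assms(2) cutI in simp_all)
next
  case (cutC T x Q)
  then have "cut_admissible (cut_free c) (InC x)"
    by (intro cut_admissible_cut_free) (use assms(3) in \<open>simp add: in_language_def\<close>)
  then show ?thesis
    unfolding cutC by (rule cut_admissibleD) (use assms(2) cutC in simp_all)
qed

lemma derivation_cut_free:
  assumes "built_by (calculus_rule c) d" and "\<forall>S\<in>sequents d. in_language c S"
  shows "cut_free c (end_sequent d)"
  using assms
proof (induction d)
  case (Infer S ds)
  then have "\<forall>Q\<in>set (map end_sequent ds). cut_free c Q"
    by auto
  moreover have "\<forall>Q\<in>set (map end_sequent ds). in_language c Q"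
    using Infer.prems end_sequent_in_sequents by auto
  moreover have "noncut_rule c (map end_sequent ds) S \<or> cut_rule (map end_sequent ds) S"
    using Infer.prems by (simp add: calculus_rule_def)
  ultimately have "cut_free c S"
    using cut_rule_cut_free by (blast intro: infer)
  then show ?case by simp
qed

lemma cut_free_built_by:
  "cut_free c S \<Longrightarrow> \<exists>d. built_by (noncut_rule c) d \<and> end_sequent d = S"
proof (induction rule: cut_free.induct)
  case (infer Ps S)
  then obtain f where "\<forall>Q\<in>set Ps. built_by (noncut_rule c) (f Q) \<and> end_sequent (f Q) = Q"
    by metis
  moreover from this have "map end_sequent (map f Ps) = Ps"
    by (simp add: map_idI)
  ultimately have "built_by (noncut_rule c) (Infer S (map f Ps))"
    using infer.hyps by simp
  then show ?case by (metis end_sequent.simps)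
qed

section \<open>Languages and subformulas in cut-free derivations\<close>
lemma tqba_inv_basic: "tqba_inv S T \<Longrightarrow> basic_sequent S \<longleftrightarrow> basic_sequent T"
  by (induction rule: tqba_inv.induct) auto

lemma tqba_rule_basic:
  "tqba_rule Ps S \<Longrightarrow> basic_sequent S \<Longrightarrow> \<forall>Q\<in>set Ps. basic_sequent Q"
  by (induction rule: tqba_rule.induct) (auto simp: tqba_inv_basic)

lemma built_by_in_language:
  assumes "built_by (noncut_rule c) d" and "in_language c (end_sequent d)"
  shows "\<forall>S\<in>sequents d. in_language c S"
  using assms
proof (induction d)
  case (Infer S ds)
  have rule: "noncut_rule c (map end_sequent ds) S"
    using Infer.prems(1) by simp
  have "in_language c Q" if "Q \<in> set (map end_sequent ds)" for Q
  proof (cases "c = TQBA")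
    case True
    then have "tqba_rule (map end_sequent ds) S" "basic_sequent S"
      using rule Infer.prems(2) by (simp_all add: in_language_def)
    then show ?thesis
      using tqba_rule_basic that unfolding in_language_def by blast
  qed (simp add: in_language_def)
  then have "\<forall>Q\<in>sequents d. in_language c Q" if "d \<in> set ds" for d
    using Infer.IH[OF that] Infer.prems(1) that by simp
  with Infer.prems(2) show ?case by simp
qed

lemma tqba_inv_fms: "tqba_inv S T \<Longrightarrow> fms_sequent S = fms_sequent T"
  by (induction rule: tqba_inv.induct) auto

lemma tqba5_inv_fms: "tqba5_inv S T \<Longrightarrow> fms_sequent S = fms_sequent T"
  by (induction rule: tqba5_inv.induct) auto

text \<open>
  A formula leaf of a premise either survives in the conclusion or is an immediate subformula
  of the principal formula. Cut is the only rule that violates this.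
\<close>
lemma rule_fms:
  "tqba_rule Ps S \<Longrightarrow> \<forall>Q\<in>set Ps. \<forall>A\<in>fms_sequent Q. \<exists>B\<in>fms_sequent S. imm_subfm\<^sup>=\<^sup>= A B"
  "tqba5_rule Ps S \<Longrightarrow> \<forall>Q\<in>set Ps. \<forall>A\<in>fms_sequent Q. \<exists>B\<in>fms_sequent S. imm_subfm\<^sup>=\<^sup>= A B"
  "ia1_rule Ps S \<Longrightarrow> \<forall>Q\<in>set Ps. \<forall>A\<in>fms_sequent Q. \<exists>B\<in>fms_sequent S. imm_subfm\<^sup>=\<^sup>= A B"
  "ia2_rule Ps S \<Longrightarrow> \<forall>Q\<in>set Ps. \<forall>A\<in>fms_sequent Q. \<exists>B\<in>fms_sequent S. imm_subfm\<^sup>=\<^sup>= A B"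
  "ia3_rule Ps S \<Longrightarrow> \<forall>Q\<in>set Ps. \<forall>A\<in>fms_sequent Q. \<exists>B\<in>fms_sequent S. imm_subfm\<^sup>=\<^sup>= A B"
  by (erule tqba_rule.cases tqba5_rule.cases ia1_rule.cases ia2_rule.cases ia3_rule.cases;
      auto simp: tqba_inv_fms tqba5_inv_fms imm_subfm.intros)+

lemma noncut_rule_subfm:
  assumes "noncut_rule c Ps S" and "Q \<in> set Ps" and "A \<in> fms_sequent Q"
  shows "\<exists>B\<in>fms_sequent S. subfm A B"
proof -
  have "\<exists>B\<in>fms_sequent S. imm_subfm\<^sup>=\<^sup>= A B"
    using assms by (cases c) (auto dest!: rule_fms)
  then show ?thesis
    by (auto simp: subfm_def)
qed

lemma subformula_property:
  assumes "built_by (noncut_rule c) d"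
  shows "\<forall>S\<in>sequents d. \<forall>A\<in>fms_sequent S. \<exists>B\<in>fms_sequent (end_sequent d). subfm A B"
  using assms
proof (induction d)
  case (Infer S ds)
  have "\<exists>B\<in>fms_sequent S. subfm A B"
    if d: "d \<in> set ds" and Q: "Q \<in> sequents d" "A \<in> fms_sequent Q" for d Q A
  proof -
    have "built_by (noncut_rule c) d"
      using Infer.prems d by simp
    then have "\<exists>C\<in>fms_sequent (end_sequent d). subfm A C"
      using Infer.IH[OF d] Q by blast
    then obtain C where C: "C \<in> fms_sequent (end_sequent d)" "subfm A C"
      by (elim bexE)
    have "noncut_rule c (map end_sequent ds) S" "end_sequent d \<in> set (map end_sequent ds)"
      using Infer.prems d by simp_all
    from noncut_rule_subfm[OF this C(1)] obtain B where B: "B \<in> fms_sequent S" "subfm C B"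
      by (elim bexE)
    have "subfm A B"
      using C(2) B(2) unfolding subfm_def by (rule rtranclp_trans)
    with B(1) show ?thesis by (rule bexI[rotated])
  qed
  moreover have "\<exists>B\<in>fms_sequent S. subfm A B" if "A \<in> fms_sequent S" for A
    using that by (auto simp: subfm_def)
  ultimately show ?case
    unfolding sequents.simps end_sequent.simps by (intro ballI, elim insertE UN_E) simp_all
qed

section \<open>Cut elimination and the subformula property\<close>
theorem mainTheorem5:
  fixes c :: calculus
  shows "(\<forall>S. derivable c S \<longrightarrow> (\<exists>d. cut_free_derivation c d \<and> end_sequent d = S)) \<and>
    (\<forall>d. cut_free_derivation c d \<longrightarrow>
      (\<forall>S\<in>sequents d. \<forall>A\<in>fms_sequent S. \<exists>B\<in>fms_sequent (end_sequent d). subfm A B))"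
proof (intro conjI allI impI)
  fix S
  assume "derivable c S"
  then obtain d where d: "built_by (calculus_rule c) d" "\<forall>S\<in>sequents d. in_language c S"
      "end_sequent d = S"
    by (auto simp: derivable_def derivation_def)
  then have lang: "in_language c S"
    using end_sequent_in_sequents by blast
  obtain d' where "built_by (noncut_rule c) d'" "end_sequent d' = S"
    using derivation_cut_free[OF d(1,2)] d(3) cut_free_built_by by blast
  then show "\<exists>d. cut_free_derivation c d \<and> end_sequent d = S"
    using built_by_in_language lang unfolding cut_free_derivation_def by blast
next
  fix d
  assume "cut_free_derivation c d"
  then show "\<forall>S\<in>sequents d. \<forall>A\<in>fms_sequent S. \<exists>B\<in>fms_sequent (end_sequent d). subfm A B"
    using subformula_property unfolding cut_free_derivation_def by blast
qed

end
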